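(* Csorba's functor $A:\mathscr{S}^{\mathbb{Z}_2}\to\mathscr{G}$ is a left adjoint functor (i.e. it has a right adjoint) and it preserves finite limits. Moreover, the geometric realization of its right adjoint $\mathscr{G}\to\mathscr{S}^{\mathbb{Z}_2}$ is naturally $\mathbb{Z}_2$-homotopy equivalent to the box complex functor $G\mapsto \mathrm{Hom}(K_2,G)$.
   Context: $\mathscr{G}$ is the category of finite graphs: a graph $G=(V(G),E(G))$ consists of a finite set $V(G)$ and a symmetric subset $E(G)\subset V(G)\times V(G)$ (loops allowed), and morphisms are graph homomorphisms, i.e. maps $f:V(G)\to V(H)$ such that $(v,w)\in E(G)$ implies $(f(v),f(w))\in E(H)$. $\mathscr{S}^{\mathbb{Z}_2}$ is the category of finite abstract simplicial complexes $K$ with a $\mathbb{Z}_2$-action, i.e. with a simplicial map $\alpha:K\to K$ satisfying $\alpha^2=\mathrm{id}_K$; morphisms are $\mathbb{Z}_2$-equivariant simplicial maps. (The vertex set $V(K)$ consists of those $v$ for which $\{v\}$ is a simplex.) Csorba's functor $A$: for a $\mathbb{Z}_2$-simplicial complex $K$ with involution $\alpha$, $A(K)$ is the graph with $V(A(K))=V(K)$ in which $v$ and $w$ are adjacent if and only if $\{\alpha(v),w\}$ is a simplex of $K$; a $\mathbb{Z}_2$-simplicial map is sent to the same map on vertices. The box complex $\mathrm{Hom}(K_2,G)$ of a graph $G$ is the polyhedral complex with one cell $S\times T$ (product of the simplices spanned by $S$ and by $T$) for each pair of non-empty subsets $S,T\subset V(G)$ with $S\times T\subset E(G)$. That is, it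 is the space of pairs $(s,t)$ of probability distributions on $V(G)$ whose supports $S,T$ satisfy $S\times T\subset E(G)$. The $\mathbb{Z}_2$-action is $(s,t)\mapsto(t,s)$, and a graph homomorphism acts by push-forward of distributions. Two functors from $\mathscr{G}$ to $\mathbb{Z}_2$-spaces are called naturally $\mathbb{Z}_2$-homotopy equivalent if there is a natural transformation between them each of whose components is a $\mathbb{Z}_2$-homotopy equivalence. *)

theory Defs
  imports "HOL-Analysis.Analysis"
begin

section \<open>Categories, functors, adjunctions, limits\<close>

record ('o, 'a) cat =
  obj :: "'o set"
  arr :: "'a set"
  src :: "'a \<Rightarrow> 'o"
  tgt :: "'a \<Rightarrow> 'o"
  ident :: "'o \<Rightarrow> 'a"
  cmp :: "'a \<Rightarrow> 'a \<Rightarrow> 'a"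

definition hom :: "('o, 'a) cat \<Rightarrow> 'o \<Rightarrow> 'o \<Rightarrow> 'a set" where
  "hom C X Y = {f \<in> arr C. src C f = X \<and> tgt C f = Y}"

locale category =
  fixes C :: "('o, 'a) cat"
  assumes src_obj: "f \<in> arr C \<Longrightarrow> src C f \<in> obj C"
    and tgt_obj: "f \<in> arr C \<Longrightarrow> tgt C f \<in> obj C"
    and ident_hom: "X \<in> obj C \<Longrightarrow> ident C X \<in> hom C X X"
    and cmp_hom: "f \<in> hom C X Y \<Longrightarrow> g \<in> hom C Y Z \<Longrightarrow> cmp C g f \<in> hom C X Z"
    and cmp_ident_right: "f \<in> hom C X Y \<Longrightarrow> cmp C f (ident C X) = f"
    and cmp_ident_left: "f \<in> hom C X Y \<Longrightarrow> cmp C (ident C Y) f = f"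
    and cmp_assoc: "f \<in> hom C W X \<Longrightarrow> g \<in> hom C X Y \<Longrightarrow> h \<in> hom C Y Z \<Longrightarrow>
      cmp C h (cmp C g f) = cmp C (cmp C h g) f"

definition finite_category :: "('o, 'a) cat \<Rightarrow> bool" where
  "finite_category J \<longleftrightarrow> category J \<and> finite (obj J) \<and> finite (arr J)"

record ('o, 'a, 'p, 'b) ftor =
  omap :: "'o \<Rightarrow> 'p"
  amap :: "'a \<Rightarrow> 'b"

locale cat_functor = S: category C + T: category D
  for C :: "('o, 'a) cat" and D :: "('p, 'b) cat" +
  fixes F :: "('o, 'a, 'p, 'b) ftor"
  assumes omap_obj: "X \<in> obj C \<Longrightarrow> omap F X \<in> obj D"
    and amap_hom: "f \<in> hom C X Y \<Longrightarrow> amap F f \<in> hom D (omap F X) (omap F Y)"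
    and amap_ident: "X \<in> obj C \<Longrightarrow> amap F (ident C X) = ident D (omap F X)"
    and amap_cmp: "f \<in> hom C X Y \<Longrightarrow> g \<in> hom C Y Z \<Longrightarrow>
      amap F (cmp C g f) = cmp D (amap F g) (amap F f)"

definition ftor_comp ::
    "('p, 'b, 'q, 'c) ftor \<Rightarrow> ('o, 'a, 'p, 'b) ftor \<Rightarrow> ('o, 'a, 'q, 'c) ftor" where
  "ftor_comp G F = \<lparr>omap = omap G \<circ> omap F, amap = amap G \<circ> amap F\<rparr>"

text \<open>\<open>adjunction C D F G\<close>: the functor \<open>F\<close> from \<open>C\<close> to \<open>D\<close> is left adjoint to \<open>G\<close>,
  i.e. there are bijections \<open>hom D (F X) Y \<rightarrow> hom C X (G Y)\<close>, natural in \<open>X\<close> and \<open>Y\<close>.\<close>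

definition adjunction ::
    "('o, 'a) cat \<Rightarrow> ('p, 'b) cat \<Rightarrow> ('o, 'a, 'p, 'b) ftor \<Rightarrow> ('p, 'b, 'o, 'a) ftor \<Rightarrow> bool" where
  "adjunction C D F G \<longleftrightarrow> cat_functor C D F \<and> cat_functor D C G \<and>
     (\<exists>\<phi>.
       (\<forall>X\<in>obj C. \<forall>Y\<in>obj D.
          bij_betw (\<phi> X Y) (hom D (omap F X) Y) (hom C X (omap G Y))) \<and>
       (\<forall>X\<in>obj C. \<forall>X'\<in>obj C. \<forall>Y\<in>obj D. \<forall>Y'\<in>obj D.
          \<forall>f\<in>hom C X' X. \<forall>g\<in>hom D Y Y'. \<forall>h\<in>hom D (omap F X) Y.
            \<phi> X' Y' (cmp D g (cmp D h (amap F f))) =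
            cmp C (amap G g) (cmp C (\<phi> X Y h) f)))"

definition cone ::
    "('i, 'j) cat \<Rightarrow> ('o, 'a) cat \<Rightarrow> ('i, 'j, 'o, 'a) ftor \<Rightarrow> 'o \<Rightarrow> ('i \<Rightarrow> 'a) \<Rightarrow> bool" where
  "cone J C F L \<pi> \<longleftrightarrow> L \<in> obj C \<and> (\<forall>i\<in>obj J. \<pi> i \<in> hom C L (omap F i)) \<and>
     (\<forall>u\<in>arr J. cmp C (amap F u) (\<pi> (src J u)) = \<pi> (tgt J u))"

definition limit_cone ::
    "('i, 'j) cat \<Rightarrow> ('o, 'a) cat \<Rightarrow> ('i, 'j, 'o, 'a) ftor \<Rightarrow> 'o \<Rightarrow> ('i \<Rightarrow> 'a) \<Rightarrow> bool" where
  "limit_cone J C F L \<pi> \<longleftrightarrow> cone J C F L \<pi> \<and>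
     (\<forall>M \<rho>. cone J C F M \<rho> \<longrightarrow>
        (\<exists>!h. h \<in> hom C M L \<and> (\<forall>i\<in>obj J. cmp C (\<pi> i) h = \<rho> i)))"

definition preserves_limits_of_shape ::
    "('i, 'j) cat \<Rightarrow> ('o, 'a) cat \<Rightarrow> ('p, 'b) cat \<Rightarrow> ('o, 'a, 'p, 'b) ftor \<Rightarrow> bool" where
  "preserves_limits_of_shape J C D F \<longleftrightarrow>
     (\<forall>K L \<pi>. cat_functor J C K \<and> limit_cone J C K L \<pi> \<longrightarrow>
        limit_cone J D (ftor_comp F K) (omap F L) (\<lambda>i. amap F (\<pi> i)))"

text \<open>A category of structured sets: \<open>Ob\<close> is the class of objects, \<open>U X\<close> the underlying set of
  \<open>X\<close>, and \<open>P X Y f\<close> says that \<open>f\<close> preserves the structure. An arrow is a triple of source,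
  underlying map and target, where the underlying map takes the value \<open>undefined\<close> outside
  the underlying set of the source, so that equal maps give equal arrows.\<close>

type_synonym ('o, 'u) carrow = "'o \<times> ('u \<Rightarrow> 'u) \<times> 'o"

definition umap :: "('o, 'u) carrow \<Rightarrow> 'u \<Rightarrow> 'u" where
  "umap a = fst (snd a)"

definition concrete_cat ::
    "'o set \<Rightarrow> ('o \<Rightarrow> 'u set) \<Rightarrow> ('o \<Rightarrow> 'o \<Rightarrow> ('u \<Rightarrow> 'u) \<Rightarrow> bool) \<Rightarrow> ('o, ('o, 'u) carrow) cat" where
  "concrete_cat Ob U P = \<lparr>
     obj = Ob,
     arr = {(X, f, Y). X \<in> Ob \<and> Y \<in> Ob \<and> f \<in> U X \<rightarrow>\<^sub>E U Y \<and> P X Y f},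
     src = (\<lambda>(X, f, Y). X),
     tgt = (\<lambda>(X, f, Y). Y),
     ident = (\<lambda>X. (X, (\<lambda>x\<in>U X. x), X)),
     cmp = (\<lambda>(Y', g, Z) (X, f, Y). (X, compose (U X) g f, Z))\<rparr>"

section \<open>Finite graphs\<close>

text \<open>Vertices are taken from a type \<open>'u\<close>. If \<open>'u\<close> is infinite, every finite graph is isomorphic
  to one of these, and likewise for the complexes below.\<close>

record 'u graph =
  verts :: "'u set"
  edges :: "('u \<times> 'u) set"

definition finite_graphs :: "'u graph set" where
  "finite_graphs = {G. finite (verts G) \<and> edges G \<subseteq> verts G \<times> verts G \<and> sym (edges G)}"

definition graph_hom :: "'u graph \<Rightarrow> 'u graph \<Rightarrow> ('u \<Rightarrow> 'u) \<Rightarrow> bool" where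
  "graph_hom G H f \<longleftrightarrow> (\<forall>(v, w)\<in>edges G. (f v, f w) \<in> edges H)"

definition Graphs :: "('u graph, ('u graph, 'u) carrow) cat" where
  "Graphs = concrete_cat finite_graphs verts graph_hom"

section \<open>Finite simplicial complexes with an involution\<close>

text \<open>Simplices are non-empty; the complex without vertices is allowed.\<close>

record 'u z2_complex =
  simplices :: "'u set set"
  invol :: "'u \<Rightarrow> 'u"

definition vertices :: "'u z2_complex \<Rightarrow> 'u set" where
  "vertices K = {v. {v} \<in> simplices K}"

definition simplicial :: "'u z2_complex \<Rightarrow> 'u z2_complex \<Rightarrow> ('u \<Rightarrow> 'u) \<Rightarrow> bool" where
  "simplicial K L f \<longleftrightarrow> (\<forall>\<sigma>\<in>simplices K. f ` \<sigma> \<in> simplices L)"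

definition finite_z2_complexes :: "'u z2_complex set" where
  "finite_z2_complexes = {K.
     finite (simplices K) \<and>
     (\<forall>\<sigma>\<in>simplices K. finite \<sigma> \<and> \<sigma> \<noteq> {}) \<and>
     (\<forall>\<sigma>\<in>simplices K. \<forall>\<tau>. \<tau> \<subseteq> \<sigma> \<and> \<tau> \<noteq> {} \<longrightarrow> \<tau> \<in> simplices K) \<and>
     invol K \<in> vertices K \<rightarrow>\<^sub>E vertices K \<and>
     simplicial K K (invol K) \<and>
     (\<forall>v\<in>vertices K. invol K (invol K v) = v)}"

definition z2_simplicial :: "'u z2_complex \<Rightarrow> 'u z2_complex \<Rightarrow> ('u \<Rightarrow> 'u) \<Rightarrow> bool" where
  "z2_simplicial K L f \<longleftrightarrow> simplicial K L f \<and>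
     (\<forall>v\<in>vertices K. f (invol K v) = invol L (f v))"

definition Z2_Complexes :: "('u z2_complex, ('u z2_complex, 'u) carrow) cat" where
  "Z2_Complexes = concrete_cat finite_z2_complexes vertices z2_simplicial"

definition csorba_graph :: "'u z2_complex \<Rightarrow> 'u graph" where
  "csorba_graph K = \<lparr>
     verts = vertices K,
     edges = {(v, w). v \<in> vertices K \<and> w \<in> vertices K \<and> {invol K v, w} \<in> simplices K}\<rparr>"

definition csorba ::
    "('u z2_complex, ('u z2_complex, 'u) carrow, 'u graph, ('u graph, 'u) carrow) ftor" where
  "csorba = \<lparr>
     omap = csorba_graph,
     amap = (\<lambda>(K, f, L). (csorba_graph K, f, csorba_graph L))\<rparr>"

section \<open>Spaces with an involution\<close>

record 'p z2_space =
  topo :: "'p topology"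
  flip :: "'p \<Rightarrow> 'p"

definition z2_spaces :: "'p z2_space set" where
  "z2_spaces = {X.
     flip X \<in> topspace (topo X) \<rightarrow>\<^sub>E topspace (topo X) \<and>
     continuous_map (topo X) (topo X) (flip X) \<and>
     (\<forall>x\<in>topspace (topo X). flip X (flip X x) = x)}"

definition equivariant :: "'p z2_space \<Rightarrow> 'q z2_space \<Rightarrow> ('p \<Rightarrow> 'q) \<Rightarrow> bool" where
  "equivariant X Y f \<longleftrightarrow> (\<forall>x\<in>topspace (topo X). f (flip X x) = flip Y (f x))"

definition z2_map :: "'p z2_space \<Rightarrow> 'q z2_space \<Rightarrow> ('p \<Rightarrow> 'q) \<Rightarrow> bool" where
  "z2_map X Y f \<longleftrightarrow> continuous_map (topo X) (topo Y) f \<and> equivariant X Y f"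

definition Z2_Spaces :: "('p z2_space, ('p z2_space, 'p) carrow) cat" where
  "Z2_Spaces = concrete_cat z2_spaces (\<lambda>X. topspace (topo X)) z2_map"

definition z2_homotopic ::
    "'p z2_space \<Rightarrow> 'q z2_space \<Rightarrow> ('p \<Rightarrow> 'q) \<Rightarrow> ('p \<Rightarrow> 'q) \<Rightarrow> bool" where
  "z2_homotopic X Y = homotopic_with (equivariant X Y) (topo X) (topo Y)"

definition z2_homotopy_equivalence ::
    "'p z2_space \<Rightarrow> 'q z2_space \<Rightarrow> ('p \<Rightarrow> 'q) \<Rightarrow> bool" where
  "z2_homotopy_equivalence X Y f \<longleftrightarrow> z2_map X Y f \<and>
     (\<exists>g. z2_map Y X g \<and> z2_homotopic X X (g \<circ> f) id \<and> z2_homotopic Y Y (f \<circ> g) id)"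

text \<open>The two functors may take values in spaces with different types of points, so the
  components of the natural transformation are given as maps of points.\<close>

definition naturally_z2_homotopy_equivalent ::
    "('o, 'a) cat \<Rightarrow>
     ('o, 'a, 'p z2_space, ('p z2_space, 'p) carrow) ftor \<Rightarrow>
     ('o, 'a, 'q z2_space, ('q z2_space, 'q) carrow) ftor \<Rightarrow> bool" where
  "naturally_z2_homotopy_equivalent C F F' \<longleftrightarrow>
     cat_functor C Z2_Spaces F \<and> cat_functor C Z2_Spaces F' \<and>
     (\<exists>\<eta>. (\<forall>X\<in>obj C. z2_homotopy_equivalence (omap F X) (omap F' X) (\<eta> X)) \<and>
       (\<forall>X\<in>obj C. \<forall>Y\<in>obj C. \<forall>f\<in>hom C X Y. \<forall>x\<in>topspace (topo (omap F X)).
          \<eta> Y (umap (amap F f) x) = umap (amap F' f) (\<eta> X x)))"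

section \<open>Geometric realization and the box complex\<close>

definition prob_dists :: "'u set \<Rightarrow> ('u \<Rightarrow> real) set" where
  "prob_dists V = {p. (\<forall>v. 0 \<le> p v) \<and> (\<forall>v. v \<notin> V \<longrightarrow> p v = 0) \<and> sum p V = 1}"

definition supp :: "('u \<Rightarrow> real) \<Rightarrow> 'u set" where
  "supp p = {v. p v \<noteq> 0}"

definition pushforward :: "'u set \<Rightarrow> ('u \<Rightarrow> 'w) \<Rightarrow> ('u \<Rightarrow> real) \<Rightarrow> 'w \<Rightarrow> real" where
  "pushforward V f p = (\<lambda>w. \<Sum>v | v \<in> V \<and> f v = w. p v)"

text \<open>Points of the realization are given by barycentric coordinates. The function type
  carries the product topology; as all points of \<open>|K|\<close> vanish outside the finite set
  \<open>vertices K\<close>, the subspace topology used here is that of a subspace of Euclidean space.\<close>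

definition realization_points :: "'u z2_complex \<Rightarrow> ('u \<Rightarrow> real) set" where
  "realization_points K = {p \<in> prob_dists (vertices K). supp p \<in> simplices K}"

definition realization_space :: "'u z2_complex \<Rightarrow> ('u \<Rightarrow> real) z2_space" where
  "realization_space K = \<lparr>
     topo = top_of_set (realization_points K),
     flip = restrict (pushforward (vertices K) (invol K)) (realization_points K)\<rparr>"

definition realization ::
    "('u z2_complex, ('u z2_complex, 'u) carrow,
      ('u \<Rightarrow> real) z2_space, (('u \<Rightarrow> real) z2_space, 'u \<Rightarrow> real) carrow) ftor" where
  "realization = \<lparr>
     omap = realization_space,
     amap = (\<lambda>(K, f, L).
       (realization_space K,
        restrict (pushforward (vertices K) f) (realization_points K),
        realization_space L))\<rparr>"

definition box_points :: "'u graph \<Rightarrow> (('u \<Rightarrow> real) \<times> ('u \<Rightarrow> real)) set" where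
  "box_points G = {(s, t). s \<in> prob_dists (verts G) \<and> t \<in> prob_dists (verts G) \<and>
     supp s \<times> supp t \<subseteq> edges G}"

definition box_space :: "'u graph \<Rightarrow> (('u \<Rightarrow> real) \<times> ('u \<Rightarrow> real)) z2_space" where
  "box_space G = \<lparr>
     topo = top_of_set (box_points G),
     flip = restrict (\<lambda>(s, t). (t, s)) (box_points G)\<rparr>"

definition box_complex ::
    "('u graph, ('u graph, 'u) carrow,
      (('u \<Rightarrow> real) \<times> ('u \<Rightarrow> real)) z2_space,
      ((('u \<Rightarrow> real) \<times> ('u \<Rightarrow> real)) z2_space, ('u \<Rightarrow> real) \<times> ('u \<Rightarrow> real)) carrow) ftor" where
  "box_complex = \<lparr>
     omap = box_space,
     amap = (\<lambda>(G, f, H).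
       (box_space G,
        restrict (\<lambda>(s, t). (pushforward (verts G) f s, pushforward (verts G) f t)) (box_points G),
        box_space H))\<rparr>"

end

theory Submission
  imports Defs
begin

text \<open>A graph homomorphism \<open>f\<close> from \<open>A(K)\<close> to \<open>G\<close> is determined by the equivariant map
  \<open>v \<mapsto> (f v, f (\<alpha> v))\<close> into \<open>E(G)\<close> with the reversal of edges, and \<open>f\<close> preserves adjacency iff this map sends
  simplices to sets \<open>\<sigma>\<close> with \<open>fst ` \<sigma> \<times> snd ` \<sigma> \<subseteq> E(G)\<close>. These sets are the simplices of the
  right adjoint of \<open>A\<close> at \<open>G\<close>. Its realization consists of distributions on \<open>E(G)\<close>; taking both marginals is a
  natural equivariant map to the box complex, and the product distribution of a pair \<open>(s, t)\<close> is a
  section of it. A distribution and the product of its marginals lie in a common simplex, so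
  the straight-line homotopy shows that the two maps are inverse up to equivariant homotopy.
  Limits are preserved because vertices and adjacencies of \<open>A(K)\<close> are both represented by equivariant maps from
  a pair of interchanged edges to \<open>K\<close>.\<close>

section \<open>Universal arrows and adjunctions\<close>

text \<open>The last claim concerns every right adjoint, not a chosen one, so exhibiting one
  explicit right adjoint is not enough. Everything is therefore phrased through universal arrows
  from \<open>csorba\<close> to a graph: their existence gives a right adjoint, and their uniqueness
  up to isomorphism shows that the counit of any right adjoint has the same description by edges.
  Naturality of the homotopy equivalence then comes from naturality of the counit. A further
  obstacle is that graphs and complexes share one vertex type \<open>'u\<close>, so edges have to be
  coded by elements of \<open>'u\<close>; infinitely many elements leave room for the edges of any
  finite graph and for the four points of the test complex used for limits.\<close>

definition universal_arrow ::
    "('o, 'a) cat \<Rightarrow> ('p, 'b) cat \<Rightarrow> ('o, 'a, 'p, 'b) ftor \<Rightarrow> 'p \<Rightarrow> 'o \<Rightarrow> 'b \<Rightarrow> bool" where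
  "universal_arrow C D F Y U e \<longleftrightarrow> U \<in> obj C \<and> e \<in> hom D (omap F U) Y \<and>
     (\<forall>X\<in>obj C. \<forall>h\<in>hom D (omap F X) Y. \<exists>!k. k \<in> hom C X U \<and> cmp D e (amap F k) = h)"

lemma universal_arrow_ex1:
  assumes "universal_arrow C D F Y U e" "X \<in> obj C" "h \<in> hom D (omap F X) Y"
  shows "\<exists>!k. k \<in> hom C X U \<and> cmp D e (amap F k) = h"
  using assms by (simp add: universal_arrow_def)

text \<open>Both arrows factor the same composite, so the uniqueness clause applies. Equations
  between arrows into \<open>U\<close> are checked below by composing with \<open>e\<close>.\<close>

lemma universal_arrow_hom_eq:
  assumes "universal_arrow C D F Y U e" "cat_functor C D F"
    and "k \<in> hom C X U" "l \<in> hom C X U" "X \<in> obj C"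
    and "cmp D e (amap F k) = cmp D e (amap F l)"
  shows "k = l"
proof -
  interpret F: cat_functor C D F by fact
  have e: "e \<in> hom D (omap F U) Y"
    using assms(1) by (simp add: universal_arrow_def)
  have "cmp D e (amap F k) \<in> hom D (omap F X) Y"
    by (rule F.T.cmp_hom[OF F.amap_hom[OF assms(3)] e])
  then have "\<exists>!m. m \<in> hom C X U \<and> cmp D e (amap F m) = cmp D e (amap F k)"
    by (rule universal_arrow_ex1[OF assms(1,5)])
  then show ?thesis
    using assms(3,4,6) by auto
qed

text \<open>Both pairs are terminal among objects \<open>X\<close> equipped with an arrow from
  \<open>omap F X\<close> to \<open>Y\<close>, and terminal objects are isomorphic. This is what
  carries a description of one right adjoint over to all others.\<close>

lemma universal_arrow_unique:
  assumes F: "cat_functor C D F"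
    and u: "universal_arrow C D F Y U e" and u': "universal_arrow C D F Y U' e'"
  obtains k l where "k \<in> hom C U U'" "l \<in> hom C U' U"
    "cmp D e' (amap F k) = e" "cmp D e (amap F l) = e'"
    "cmp C l k = ident C U" "cmp C k l = ident C U'"
proof -
  interpret F: cat_functor C D F by fact
  have *: "\<exists>k. k \<in> hom C V W \<and> cmp D b (amap F k) = a"
    if "universal_arrow C D F Y V a" "universal_arrow C D F Y W b" for V W a b
    using that unfolding universal_arrow_def by meson
  \<comment> \<open>Proved for generic \<open>V\<close> and \<open>W\<close>, so that interchanging
    the two universal arrows gives the other composite as well.\<close>
  have inv: "cmp C l k = ident C V"
    if "universal_arrow C D F Y V a" "universal_arrow C D F Y W b"
      "k \<in> hom C V W" "l \<in> hom C W V" "cmp D b (amap F k) = a" "cmp D a (amap F l) = b"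
    for V W a b k l
  proof (rule universal_arrow_hom_eq[OF that(1) F])
    show V: "V \<in> obj C"
      using that(1) by (simp add: universal_arrow_def)
    then show "ident C V \<in> hom C V V"
      by (rule F.S.ident_hom)
    show "cmp C l k \<in> hom C V V"
      using that F.S.cmp_hom by blast
    have a: "a \<in> hom D (omap F V) Y"
      using that(1) by (simp add: universal_arrow_def)
    have "cmp D a (amap F (cmp C l k)) = cmp D a (cmp D (amap F l) (amap F k))"
      using F.amap_cmp that by metis
    also have "\<dots> = cmp D (cmp D a (amap F l)) (amap F k)"
      using F.T.cmp_assoc F.amap_hom a that(3,4) by blast
    also have "\<dots> = cmp D a (amap F (ident C V))"
      using a V that by (simp add: F.amap_ident F.T.cmp_ident_right)
    finally show "cmp D a (amap F (cmp C l k)) = cmp D a (amap F (ident C V))" .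
  qed
  obtain k l where kl: "k \<in> hom C U U'" "cmp D e' (amap F k) = e"
      "l \<in> hom C U' U" "cmp D e (amap F l) = e'"
    using *[OF u u'] *[OF u' u] by blast
  show thesis
    using that kl inv[OF u u' kl(1,3,2,4)] inv[OF u' u kl(3,1,4,2)] by blast
qed

text \<open>A right adjoint can be assembled object by object: once a universal arrow is chosen at
  every \<open>Y\<close>, its uniqueness clause forces the action on arrows, functoriality and
  naturality, each being an equation that may be tested after composition with
  \<open>e\<close>.\<close>

lemma adjunction_if_universal_arrows:
  assumes "cat_functor C D F"
    and "\<And>Y. Y \<in> obj D \<Longrightarrow> \<exists>U e. universal_arrow C D F Y U e"
  shows "\<exists>R. adjunction C D F R"
proof -
  interpret F: cat_functor C D F by fact
  \<comment> \<open>A universal arrow is unique only up to isomorphism, hence a choice of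
    \<open>U\<close> and \<open>e\<close>; the factorization \<open>\<phi>\<close> is unique, hence
    a definite description.\<close>
  define U where "U Y = (SOME U. \<exists>e. universal_arrow C D F Y U e)" for Y
  define e where "e Y = (SOME e. universal_arrow C D F Y (U Y) e)" for Y
  have u: "universal_arrow C D F Y (U Y) (e Y)" if "Y \<in> obj D" for Y
    unfolding U_def e_def by (rule someI_ex[OF someI_ex[OF assms(2)[OF that]]])
  define \<phi> where "\<phi> X Y h = (THE k. k \<in> hom C X (U Y) \<and> cmp D (e Y) (amap F k) = h)" for X Y h
  have U: "U Y \<in> obj C" and e: "e Y \<in> hom D (omap F (U Y)) Y" if "Y \<in> obj D" for Y
    using u[OF that] by (auto simp: universal_arrow_def)
  have \<phi>: "\<phi> X Y h \<in> hom C X (U Y)" "cmp D (e Y) (amap F (\<phi> X Y h)) = h"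
    if "X \<in> obj C" "Y \<in> obj D" "h \<in> hom D (omap F X) Y" for X Y h
  proof -
    show "\<phi> X Y h \<in> hom C X (U Y)" "cmp D (e Y) (amap F (\<phi> X Y h)) = h"
      using theI'[OF universal_arrow_ex1[OF u[OF that(2)] that(1,3)]] unfolding \<phi>_def by blast+
  qed
  have eq: "k = l" if "X \<in> obj C" "Y \<in> obj D" "k \<in> hom C X (U Y)" "l \<in> hom C X (U Y)"
      "cmp D (e Y) (amap F k) = cmp D (e Y) (amap F l)" for X Y k l
    using universal_arrow_hom_eq[OF u[OF that(2)] assms(1) that(3,4,1,5)] .
  have objs: "X \<in> obj D" "Y \<in> obj D" if "g \<in> hom D X Y" for X Y g
    using that F.T.src_obj F.T.tgt_obj by (auto simp: hom_def)
  have objsC: "X \<in> obj C" "Y \<in> obj C" if "g \<in> hom C X Y" for X Y g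
    using that F.S.src_obj F.S.tgt_obj by (auto simp: hom_def)
  \<comment> \<open>On \<open>g\<close> the functor has to be the transpose of \<open>g\<close>
    after \<open>e (src D g)\<close>; this is naturality of the counit, which is then recorded as
    the second part of the fact \<open>R\<close>.\<close>
  define R where "R = \<lparr>omap = U, amap = (\<lambda>g. \<phi> (U (src D g)) (tgt D g) (cmp D g (e (src D g))))\<rparr>"
  have R: "amap R g \<in> hom C (U Y) (U Y')" "cmp D (e Y') (amap F (amap R g)) = cmp D g (e Y)"
    if "g \<in> hom D Y Y'" for g Y Y'
  proof -
    have "src D g = Y" "tgt D g = Y'"
      using that by (auto simp: hom_def)
    then have "amap R g = \<phi> (U Y) Y' (cmp D g (e Y))"
      by (simp add: R_def)
    moreover have "cmp D g (e Y) \<in> hom D (omap F (U Y)) Y'"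
      using e that objs F.T.cmp_hom by blast
    ultimately show "amap R g \<in> hom C (U Y) (U Y')"
        "cmp D (e Y') (amap F (amap R g)) = cmp D g (e Y)"
      using \<phi> U objs[OF that] by auto
  qed
  have "cat_functor D C R"
  proof
    show "omap R Y \<in> obj C" if "Y \<in> obj D" for Y
      using U that by (simp add: R_def)
    show "amap R g \<in> hom C (omap R Y) (omap R Y')" if "g \<in> hom D Y Y'" for g Y Y'
      using R that by (simp add: R_def)
    show "amap R (ident D Y) = ident C (omap R Y)" if Y: "Y \<in> obj D" for Y
    proof (rule eq[OF U[OF Y] Y])
      show "amap R (ident D Y) \<in> hom C (U Y) (U Y)"
        using R F.T.ident_hom Y by blast
      show "ident C (omap R Y) \<in> hom C (U Y) (U Y)"
        using F.S.ident_hom U Y by (simp add: R_def)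
      show "cmp D (e Y) (amap F (amap R (ident D Y))) = cmp D (e Y) (amap F (ident C (omap R Y)))"
        using R(2)[OF F.T.ident_hom[OF Y]] e[OF Y] U[OF Y]
        by (simp add: R_def F.amap_ident F.T.cmp_ident_left F.T.cmp_ident_right)
    qed
    show "amap R (cmp D g f) = cmp C (amap R g) (amap R f)"
      if f: "f \<in> hom D X Y" and g: "g \<in> hom D Y Z" for X Y Z f g
    proof (rule eq)
      show "U X \<in> obj C" "Z \<in> obj D"
        using objs f g U by auto
      have gf: "cmp D g f \<in> hom D X Z"
        using f g F.T.cmp_hom by blast
      show "amap R (cmp D g f) \<in> hom C (U X) (U Z)"
        using gf R by blast
      show "cmp C (amap R g) (amap R f) \<in> hom C (U X) (U Z)"
        using R f g F.S.cmp_hom by blast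
      have "cmp D (e Z) (amap F (cmp C (amap R g) (amap R f))) =
          cmp D (e Z) (cmp D (amap F (amap R g)) (amap F (amap R f)))"
        using F.amap_cmp[OF R(1)[OF f] R(1)[OF g]] by simp
      also have "\<dots> = cmp D (cmp D (e Z) (amap F (amap R g))) (amap F (amap R f))"
        by (rule F.T.cmp_assoc[OF F.amap_hom[OF R(1)[OF f]] F.amap_hom[OF R(1)[OF g]] e[OF objs(2)[OF g]]])
      also have "\<dots> = cmp D (cmp D g (e Y)) (amap F (amap R f))"
        using R(2)[OF g] by simp
      also have "\<dots> = cmp D g (cmp D (e Y) (amap F (amap R f)))"
        by (rule F.T.cmp_assoc[OF F.amap_hom[OF R(1)[OF f]] e[OF objs(2)[OF f]] g, symmetric])
      also have "\<dots> = cmp D (cmp D g f) (e X)"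
        using F.T.cmp_assoc[OF e[OF objs(1)[OF f]] f g] R(2)[OF f] by simp
      finally show "cmp D (e Z) (amap F (amap R (cmp D g f))) =
          cmp D (e Z) (amap F (cmp C (amap R g) (amap R f)))"
        using R(2)[OF gf] by simp
    qed
  qed
  moreover have "bij_betw (\<phi> X Y) (hom D (omap F X) Y) (hom C X (omap R Y))"
    if X: "X \<in> obj C" and Y: "Y \<in> obj D" for X Y
  \<comment> \<open>The inverse of transposition composes \<open>amap F k\<close> with the
    counit.\<close>
  proof (rule bij_betw_byWitness[where f' = "\<lambda>k. cmp D (e Y) (amap F k)"])
    show "\<forall>h\<in>hom D (omap F X) Y. cmp D (e Y) (amap F (\<phi> X Y h)) = h"
      using \<phi> X Y by blast
    have *: "cmp D (e Y) (amap F k) \<in> hom D (omap F X) Y" if "k \<in> hom C X (U Y)" for k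
      using that e[OF Y] F.amap_hom F.T.cmp_hom by blast
    then show "(\<lambda>k. cmp D (e Y) (amap F k)) ` hom C X (omap R Y) \<subseteq> hom D (omap F X) Y"
      by (auto simp: R_def)
    have "\<phi> X Y (cmp D (e Y) (amap F k)) = k" if "k \<in> hom C X (U Y)" for k
      using eq[OF X Y \<phi>(1)[OF X Y *[OF that]] that \<phi>(2)[OF X Y *[OF that]]] .
    then show "\<forall>k\<in>hom C X (omap R Y). \<phi> X Y (cmp D (e Y) (amap F k)) = k"
      by (simp add: R_def)
    show "\<phi> X Y ` hom D (omap F X) Y \<subseteq> hom C X (omap R Y)"
      using \<phi> X Y by (auto simp: R_def)
  qed
  moreover have "\<phi> X' Y' (cmp D g (cmp D h (amap F f))) = cmp C (amap R g) (cmp C (\<phi> X Y h) f)"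
    if f: "f \<in> hom C X' X" and g: "g \<in> hom D Y Y'" and h: "h \<in> hom D (omap F X) Y"
    for X X' Y Y' f g h
  proof (rule eq)
    have X: "X' \<in> obj C" "X \<in> obj C" and Y: "Y \<in> obj D" "Y' \<in> obj D"
      using objsC[OF f] objs[OF g] by auto
    show "X' \<in> obj C" "Y' \<in> obj D" by fact+
    have Ff: "amap F f \<in> hom D (omap F X') (omap F X)"
      using f F.amap_hom by blast
    have hf: "cmp D h (amap F f) \<in> hom D (omap F X') Y"
      using Ff h F.T.cmp_hom by blast
    then have ghf: "cmp D g (cmp D h (amap F f)) \<in> hom D (omap F X') Y'"
      using g F.T.cmp_hom by blast
    then show "\<phi> X' Y' (cmp D g (cmp D h (amap F f))) \<in> hom C X' (U Y')"
      using \<phi> X Y by blast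
    have k: "\<phi> X Y h \<in> hom C X (U Y)" "cmp D (e Y) (amap F (\<phi> X Y h)) = h"
      using \<phi> h X Y by auto
    then have kf: "cmp C (\<phi> X Y h) f \<in> hom C X' (U Y)"
      using f F.S.cmp_hom by blast
    then show "cmp C (amap R g) (cmp C (\<phi> X Y h) f) \<in> hom C X' (U Y')"
      using F.S.cmp_hom R g by blast
    have "cmp D (e Y') (amap F (cmp C (amap R g) (cmp C (\<phi> X Y h) f))) =
        cmp D (e Y') (cmp D (amap F (amap R g)) (amap F (cmp C (\<phi> X Y h) f)))"
      using F.amap_cmp[OF kf R(1)[OF g]] by simp
    also have "\<dots> = cmp D (cmp D (e Y') (amap F (amap R g))) (amap F (cmp C (\<phi> X Y h) f))"
      by (rule F.T.cmp_assoc[OF F.amap_hom[OF kf] F.amap_hom[OF R(1)[OF g]] e[OF Y(2)]])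
    also have "\<dots> = cmp D (cmp D g (e Y)) (amap F (cmp C (\<phi> X Y h) f))"
      using R(2)[OF g] by simp
    also have "\<dots> = cmp D g (cmp D (e Y) (amap F (cmp C (\<phi> X Y h) f)))"
      by (rule F.T.cmp_assoc[OF F.amap_hom[OF kf] e[OF Y(1)] g, symmetric])
    also have "\<dots> = cmp D g (cmp D (e Y) (cmp D (amap F (\<phi> X Y h)) (amap F f)))"
      using F.amap_cmp[OF f k(1)] by simp
    also have "\<dots> = cmp D g (cmp D h (amap F f))"
      using F.T.cmp_assoc[OF Ff F.amap_hom[OF k(1)] e[OF Y(1)]] k(2) by simp
    finally show "cmp D (e Y') (amap F (\<phi> X' Y' (cmp D g (cmp D h (amap F f))))) =
        cmp D (e Y') (amap F (cmp C (amap R g) (cmp C (\<phi> X Y h) f)))"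
      using \<phi> ghf X Y by simp
  qed
  ultimately have "adjunction C D F R"
    unfolding adjunction_def using assms(1) by blast
  then show ?thesis by blast
qed

text \<open>The counit at \<open>Y\<close> corresponds under \<open>\<phi>\<close> to the identity
  of \<open>omap R Y\<close>, and naturality of \<open>\<phi>\<close> shows that composition with it
  inverts \<open>\<phi>\<close>, as in the Yoneda lemma. Naturality of the counit is part of the
  conclusion because it later provides the naturality square for the marginals.\<close>

lemma adjunction_counit:
  assumes "adjunction C D F R"
  obtains e where "\<And>Y. Y \<in> obj D \<Longrightarrow> universal_arrow C D F Y (omap R Y) (e Y)"
    and "\<And>Y Y' g. g \<in> hom D Y Y' \<Longrightarrow> cmp D g (e Y) = cmp D (e Y') (amap F (amap R g))"
proof -
  note adj = assms[unfolded adjunction_def]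
  interpret F: cat_functor C D F using adj by (rule conjunct1)
  interpret R: cat_functor D C R using adj[THEN conjunct2] by (rule conjunct1)
  obtain \<phi> where \<phi>:
    "(\<forall>X\<in>obj C. \<forall>Y\<in>obj D. bij_betw (\<phi> X Y) (hom D (omap F X) Y) (hom C X (omap R Y))) \<and>
     (\<forall>X\<in>obj C. \<forall>X'\<in>obj C. \<forall>Y\<in>obj D. \<forall>Y'\<in>obj D.
        \<forall>f\<in>hom C X' X. \<forall>g\<in>hom D Y Y'. \<forall>h\<in>hom D (omap F X) Y.
          \<phi> X' Y' (cmp D g (cmp D h (amap F f))) = cmp C (amap R g) (cmp C (\<phi> X Y h) f))"
    using adj[THEN conjunct2, THEN conjunct2] by (rule exE)
  note bij = \<phi>[THEN conjunct1, THEN bspec, THEN bspec]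
    and nat0 = \<phi>[THEN conjunct2, THEN bspec, THEN bspec, THEN bspec, THEN bspec, THEN bspec,
      THEN bspec, THEN bspec]
  have objs: "X \<in> obj D" "Y \<in> obj D" if "g \<in> hom D X Y" for X Y g
    using that F.T.src_obj F.T.tgt_obj by (auto simp: hom_def)
  have objsC: "X \<in> obj C" "Y \<in> obj C" if "g \<in> hom C X Y" for X Y g
    using that F.S.src_obj F.S.tgt_obj by (auto simp: hom_def)
  have nat: "\<phi> X' Y' (cmp D g (cmp D h (amap F f))) = cmp C (amap R g) (cmp C (\<phi> X Y h) f)"
    if "f \<in> hom C X' X" "g \<in> hom D Y Y'" "h \<in> hom D (omap F X) Y" for X X' Y Y' f g h
    by (rule nat0[OF objsC(2)[OF that(1)] objsC(1)[OF that(1)] objs[OF that(2)] that])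
  define e where "e Y = inv_into (hom D (omap F (omap R Y)) Y) (\<phi> (omap R Y) Y) (ident C (omap R Y))" for Y
  have e: "e Y \<in> hom D (omap F (omap R Y)) Y" "\<phi> (omap R Y) Y (e Y) = ident C (omap R Y)"
    if "Y \<in> obj D" for Y
  proof -
    have *: "ident C (omap R Y) \<in> \<phi> (omap R Y) Y ` hom D (omap F (omap R Y)) Y"
      using bij_betw_imp_surj_on[OF bij[OF R.omap_obj[OF that] that]]
        F.S.ident_hom[OF R.omap_obj[OF that]] by simp
    show "e Y \<in> hom D (omap F (omap R Y)) Y" "\<phi> (omap R Y) Y (e Y) = ident C (omap R Y)"
      unfolding e_def using inv_into_into[OF *] f_inv_into_f[OF *] by auto
  qed
  \<comment> \<open>Naturality with \<open>g\<close> an identity and \<open>h = e Y\<close> turns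
    the left side into \<open>\<phi> (omap R Y) Y (e Y)\<close> after \<open>k\<close>, and the
    first factor is an identity.\<close>
  have \<phi>e: "\<phi> X Y (cmp D (e Y) (amap F k)) = k" if "k \<in> hom C X (omap R Y)" "Y \<in> obj D" for X Y k
  proof -
    have "cmp D (e Y) (amap F k) \<in> hom D (omap F X) Y"
      using e that F.amap_hom F.T.cmp_hom by blast
    then show ?thesis
      using nat[OF that(1) F.T.ident_hom[OF that(2)] e(1)[OF that(2)]] that e(2)[OF that(2)]
      by (simp add: F.T.cmp_ident_left R.amap_ident F.S.cmp_ident_left)
  qed
  have inj: "h = h'" if "X \<in> obj C" "Y \<in> obj D" "h \<in> hom D (omap F X) Y" "h' \<in> hom D (omap F X) Y"
      "\<phi> X Y h = \<phi> X Y h'" for X Y h h'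
    using bij[OF that(1,2)] that(3-5) by (meson bij_betw_def inj_on_def)
  show thesis
  proof
    fix Y assume Y: "Y \<in> obj D"
    have "\<exists>!k. k \<in> hom C X (omap R Y) \<and> cmp D (e Y) (amap F k) = h"
      if X: "X \<in> obj C" and h: "h \<in> hom D (omap F X) Y" for X h
    proof (rule ex1I[of _ "\<phi> X Y h"])
      have k: "\<phi> X Y h \<in> hom C X (omap R Y)"
        using bij[OF X Y] h by (rule bij_betwE[THEN bspec])
      moreover have "cmp D (e Y) (amap F (\<phi> X Y h)) = h"
      proof (rule inj[OF X Y _ h])
        show "cmp D (e Y) (amap F (\<phi> X Y h)) \<in> hom D (omap F X) Y"
          using F.T.cmp_hom[OF F.amap_hom[OF k] e(1)[OF Y]] .
      qed (rule \<phi>e[OF k Y])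
      ultimately show "\<phi> X Y h \<in> hom C X (omap R Y) \<and> cmp D (e Y) (amap F (\<phi> X Y h)) = h"
        by blast
      show "k = \<phi> X Y h" if "k \<in> hom C X (omap R Y) \<and> cmp D (e Y) (amap F k) = h" for k
        using that \<phi>e Y by metis
    qed
    then show "universal_arrow C D F Y (omap R Y) (e Y)"
      unfolding universal_arrow_def using Y R.omap_obj e by blast
  next
    fix Y Y' g assume g: "g \<in> hom D Y Y'"
    have Y: "Y \<in> obj D" "Y' \<in> obj D"
      using objs[OF g] by auto
    have RY: "omap R Y \<in> obj C"
      using R.omap_obj Y by blast
    have Rg: "amap R g \<in> hom C (omap R Y) (omap R Y')"
      using R.amap_hom g by blast
    \<comment> \<open>Both sides are sent by \<open>\<phi>\<close> to \<open>amap R g\<close>: the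
      right one by \<open>\<phi>e\<close>, the left one by naturality at the identity of
      \<open>omap R Y\<close>.\<close>
    show "cmp D g (e Y) = cmp D (e Y') (amap F (amap R g))"
    proof (rule inj[OF RY Y(2)])
      show "cmp D g (e Y) \<in> hom D (omap F (omap R Y)) Y'"
        by (rule F.T.cmp_hom[OF e(1)[OF Y(1)] g])
      show "cmp D (e Y') (amap F (amap R g)) \<in> hom D (omap F (omap R Y)) Y'"
        by (rule F.T.cmp_hom[OF F.amap_hom[OF Rg] e(1)[OF Y(2)]])
      have "cmp D (e Y) (amap F (ident C (omap R Y))) = e Y"
        using F.T.cmp_ident_right[OF e(1)[OF Y(1)]] by (simp only: F.amap_ident[OF RY])
      moreover have "cmp C (amap R g) (cmp C (ident C (omap R Y)) (ident C (omap R Y))) = amap R g"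
        by (simp only: F.S.cmp_ident_right[OF F.S.ident_hom[OF RY]] F.S.cmp_ident_right[OF Rg])
      ultimately have "\<phi> (omap R Y) Y' (cmp D g (e Y)) = amap R g"
        using nat[OF F.S.ident_hom[OF RY] g e(1)[OF Y(1)]] by (simp only: e(2)[OF Y(1)])
      then show "\<phi> (omap R Y) Y' (cmp D g (e Y)) =
          \<phi> (omap R Y) Y' (cmp D (e Y') (amap F (amap R g)))"
        by (simp only: \<phi>e[OF Rg Y(2)])
    qed
  qed
qed

section \<open>Concrete categories\<close>

lemma hom_concrete_cat:
  "a \<in> hom (concrete_cat Ob U P) X Y \<longleftrightarrow>
     X \<in> Ob \<and> Y \<in> Ob \<and> (\<exists>f. a = (X, f, Y) \<and> f \<in> U X \<rightarrow>\<^sub>E U Y \<and> P X Y f)"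
  by (auto simp: hom_def concrete_cat_def)

lemma concrete_cat_simps [simp]:
  "obj (concrete_cat Ob U P) = Ob"
  "ident (concrete_cat Ob U P) X = (X, (\<lambda>x\<in>U X. x), X)"
  "cmp (concrete_cat Ob U P) (Y', g, Z) (X, f, Y) = (X, compose (U X) g f, Z)"
  by (simp_all add: concrete_cat_def)

text \<open>Underlying maps are extensional, so associativity and the unit laws hold as equalities
  of functions; only closure of \<open>P\<close> under identities and composition is left to
  check.\<close>

lemma category_concrete_cat:
  assumes "\<And>X. X \<in> Ob \<Longrightarrow> P X X (\<lambda>x\<in>U X. x)"
    and "\<And>X Y Z f g. X \<in> Ob \<Longrightarrow> Y \<in> Ob \<Longrightarrow> Z \<in> Ob \<Longrightarrow> f \<in> U X \<rightarrow>\<^sub>E U Y \<Longrightarrow> g \<in> U Y \<rightarrow>\<^sub>E U Z \<Longrightarrow>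
      P X Y f \<Longrightarrow> P Y Z g \<Longrightarrow> P X Z (compose (U X) g f)"
  shows "category (concrete_cat Ob U P)"
proof
  let ?C = "concrete_cat Ob U P"
  show "src ?C a \<in> obj ?C" "tgt ?C a \<in> obj ?C" if "a \<in> arr ?C" for a
    using that by (auto simp: concrete_cat_def)
  show "ident ?C X \<in> hom ?C X X" if "X \<in> obj ?C" for X
    using that assms(1) by (auto simp: hom_concrete_cat)
  show "cmp ?C b a \<in> hom ?C X Z" if "a \<in> hom ?C X Y" "b \<in> hom ?C Y Z" for a b X Y Z
    using that assms(2)
    by (fastforce simp: hom_concrete_cat compose_def PiE_iff)
  show "cmp ?C a (ident ?C X) = a" "cmp ?C (ident ?C Y) a = a" if "a \<in> hom ?C X Y" for a X Y
    using that by (auto simp: hom_concrete_cat intro!: ext) (auto simp: compose_def extensional_def PiE_iff)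
  show "cmp ?C c (cmp ?C b a) = cmp ?C (cmp ?C c b) a"
    if "a \<in> hom ?C W X" "b \<in> hom ?C X Y" "c \<in> hom ?C Y Z" for a b c W X Y Z
    using that by (auto simp: hom_concrete_cat compose_def PiE_iff extensional_def fun_eq_iff)
qed

section \<open>Graphs and complexes\<close>

lemma hom_Graphs:
  "a \<in> hom Graphs G H \<longleftrightarrow> G \<in> finite_graphs \<and> H \<in> finite_graphs \<and>
     (\<exists>f. a = (G, f, H) \<and> f \<in> verts G \<rightarrow>\<^sub>E verts H \<and> graph_hom G H f)"
  by (simp add: Graphs_def hom_concrete_cat)

lemma hom_Z2_Complexes:
  "a \<in> hom Z2_Complexes K L \<longleftrightarrow> K \<in> finite_z2_complexes \<and> L \<in> finite_z2_complexes \<and>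
     (\<exists>f. a = (K, f, L) \<and> f \<in> vertices K \<rightarrow>\<^sub>E vertices L \<and> z2_simplicial K L f)"
  by (simp add: Z2_Complexes_def hom_concrete_cat)

lemma Graphs_simps [simp]:
  "obj Graphs = finite_graphs"
  "ident Graphs G = (G, (\<lambda>v\<in>verts G. v), G)"
  "cmp Graphs (H', g, I) (G, f, H) = (G, compose (verts G) g f, I)"
  by (simp_all add: Graphs_def)

lemma Z2_Complexes_simps [simp]:
  "obj Z2_Complexes = finite_z2_complexes"
  "ident Z2_Complexes K = (K, (\<lambda>v\<in>vertices K. v), K)"
  "cmp Z2_Complexes (L', g, M) (K, f, L) = (K, compose (vertices K) g f, M)"
  by (simp_all add: Z2_Complexes_def)

lemma umap_simp [simp]: "umap (X, f, Y) = f"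
  by (simp add: umap_def)

lemma
  assumes "K \<in> finite_z2_complexes"
  shows simplex_subset: "\<sigma> \<in> simplices K \<Longrightarrow> \<tau> \<subseteq> \<sigma> \<Longrightarrow> \<tau> \<noteq> {} \<Longrightarrow> \<tau> \<in> simplices K"
    and simplex_nonempty: "\<sigma> \<in> simplices K \<Longrightarrow> \<sigma> \<noteq> {}"
    and invol_vertex: "v \<in> vertices K \<Longrightarrow> invol K v \<in> vertices K"
    and invol_invol: "v \<in> vertices K \<Longrightarrow> invol K (invol K v) = v"
    and invol_simplex: "\<sigma> \<in> simplices K \<Longrightarrow> invol K ` \<sigma> \<in> simplices K"
proof -
  note K = assms[unfolded finite_z2_complexes_def mem_Collect_eq, THEN conjunct2]
  note ne = K[THEN conjunct1] and K = K[THEN conjunct2]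
  note sub = K[THEN conjunct1] and K = K[THEN conjunct2]
  note maps = K[THEN conjunct1] and K = K[THEN conjunct2]
  note simp = K[THEN conjunct1] and inv = K[THEN conjunct2]
  show "\<sigma> \<in> simplices K \<Longrightarrow> \<tau> \<subseteq> \<sigma> \<Longrightarrow> \<tau> \<noteq> {} \<Longrightarrow> \<tau> \<in> simplices K"
    using sub by blast
  show "\<sigma> \<in> simplices K \<Longrightarrow> \<sigma> \<noteq> {}"
    using ne by blast
  show "v \<in> vertices K \<Longrightarrow> invol K (invol K v) = v"
    using inv by blast
  show "v \<in> vertices K \<Longrightarrow> invol K v \<in> vertices K"
    by (rule PiE_mem[OF maps])
  show "\<sigma> \<in> simplices K \<Longrightarrow> invol K ` \<sigma> \<in> simplices K"
    using simp unfolding simplicial_def by blast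
qed

lemma simplex_vertex: "v \<in> vertices K"
  if "K \<in> finite_z2_complexes" "\<sigma> \<in> simplices K" "v \<in> \<sigma>"
  using simplex_subset[OF that(1,2), of "{v}"] that(3) by (simp add: vertices_def)

lemma finite_vertices: "finite (vertices K)" if "K \<in> finite_z2_complexes"
proof -
  have "vertices K \<subseteq> \<Union> (simplices K)"
    by (auto simp: vertices_def)
  moreover have "finite (\<Union> (simplices K))"
    using that by (auto simp: finite_z2_complexes_def)
  ultimately show ?thesis
    by (rule finite_subset)
qed

lemma
  assumes "z2_simplicial K L f"
  shows z2_simplicial_image: "\<sigma> \<in> simplices K \<Longrightarrow> f ` \<sigma> \<in> simplices L"
    and z2_simplicial_invol: "v \<in> vertices K \<Longrightarrow> f (invol K v) = invol L (f v)"
  using assms by (auto simp: z2_simplicial_def simplicial_def)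

section \<open>The two categories and Csorba's functor between them\<close>

lemma category_Graphs: "category Graphs"
  unfolding Graphs_def
proof (rule category_concrete_cat)
  show "graph_hom G G (\<lambda>x\<in>verts G. x)" if "G \<in> finite_graphs" for G
    using that by (force simp: graph_hom_def finite_graphs_def)
  show "graph_hom G I (compose (verts G) g f)"
    if "G \<in> finite_graphs" "graph_hom G H f" "graph_hom H I g" for G H I and f g :: "'a \<Rightarrow> 'a"
    using that by (force simp: graph_hom_def finite_graphs_def compose_def)
qed

lemma category_Z2_Complexes: "category Z2_Complexes"
  unfolding Z2_Complexes_def
proof (rule category_concrete_cat)
  show "z2_simplicial K K (\<lambda>x\<in>vertices K. x)" if K: "K \<in> finite_z2_complexes" for K
  proof -
    have "(\<lambda>x\<in>vertices K. x) ` \<sigma> = \<sigma>" if "\<sigma> \<in> simplices K" for \<sigma>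
      using simplex_vertex[OF K that] by (auto simp: image_iff)
    then show ?thesis
      using invol_vertex[OF K] by (auto simp: z2_simplicial_def simplicial_def)
  qed
  show "z2_simplicial K M (compose (vertices K) g f)"
    if K: "K \<in> finite_z2_complexes" and f: "f \<in> vertices K \<rightarrow>\<^sub>E vertices L" "z2_simplicial K L f"
      and g: "z2_simplicial L M g" for K L M and f g :: "'a \<Rightarrow> 'a"
  proof -
    have "compose (vertices K) g f ` \<sigma> = g ` f ` \<sigma>" if "\<sigma> \<in> simplices K" for \<sigma>
      using simplex_vertex[OF K that] by (auto simp: image_iff compose_def)
    then show ?thesis
      using f g invol_vertex[OF K] PiE_mem[OF f(1)]
      by (auto simp: z2_simplicial_def simplicial_def compose_def)
  qed
qed

lemma csorba_simps [simp]:
  "omap csorba K = csorba_graph K"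
  "amap csorba (K, f, L) = (csorba_graph K, f, csorba_graph L)"
  "verts (csorba_graph K) = vertices K"
  by (simp_all add: csorba_def csorba_graph_def)

lemma edges_csorba_graph: "(v, w) \<in> edges (csorba_graph K) \<longleftrightarrow>
    v \<in> vertices K \<and> w \<in> vertices K \<and> {invol K v, w} \<in> simplices K"
  by (simp add: csorba_graph_def)

text \<open>Adjacency is symmetric because the involution carries \<open>{invol K v, w}\<close> to
  \<open>{v, invol K w}\<close>.\<close>

lemma csorba_graph_finite: "csorba_graph K \<in> finite_graphs" if K: "K \<in> finite_z2_complexes"
proof -
  have "{invol K w, v} \<in> simplices K"
    if "v \<in> vertices K" "{invol K v, w} \<in> simplices K" for v w
    using invol_simplex[OF K that(2)] invol_invol[OF K that(1)] by (simp add: insert_commute)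
  then have "sym (edges (csorba_graph K))"
    by (auto simp: sym_def edges_csorba_graph)
  then show ?thesis
    using finite_vertices[OF K] by (auto simp: finite_graphs_def edges_csorba_graph)
qed

lemma graph_hom_csorba_graph:
  assumes "z2_simplicial K L f" "f \<in> vertices K \<rightarrow>\<^sub>E vertices L"
  shows "graph_hom (csorba_graph K) (csorba_graph L) f"
proof -
  have "{invol L (f v), f w} \<in> simplices L" if "v \<in> vertices K" "{invol K v, w} \<in> simplices K" for v w
    using z2_simplicial_image[OF assms(1) that(2)] z2_simplicial_invol[OF assms(1) that(1)] by simp
  then show ?thesis
    using PiE_mem[OF assms(2)] by (auto simp: graph_hom_def edges_csorba_graph)
qed

lemma cat_functor_csorba: "cat_functor Z2_Complexes Graphs csorba"
proof -
  interpret S: category Z2_Complexes by (rule category_Z2_Complexes)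
  interpret T: category Graphs by (rule category_Graphs)
  show ?thesis
    by unfold_locales
      (auto simp: csorba_graph_finite hom_Z2_Complexes hom_Graphs intro: graph_hom_csorba_graph)
qed

section \<open>Preservation of limits\<close>

lemma cone_functor_image:
  assumes F: "cat_functor C D F" and K: "cat_functor J C K" and cone: "cone J C K L \<pi>"
  shows "cone J D (ftor_comp F K) (omap F L) (\<lambda>i. amap F (\<pi> i))"
proof -
  interpret F: cat_functor C D F by fact
  interpret K: cat_functor J C K by fact
  have L: "L \<in> obj C" and \<pi>: "\<And>i. i \<in> obj J \<Longrightarrow> \<pi> i \<in> hom C L (omap K i)"
    and comm: "\<And>u. u \<in> arr J \<Longrightarrow> cmp C (amap K u) (\<pi> (src J u)) = \<pi> (tgt J u)"
    using cone unfolding cone_def by auto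
  have "cmp D (amap F (amap K u)) (amap F (\<pi> (src J u))) = amap F (\<pi> (tgt J u))"
    if u: "u \<in> arr J" for u
  proof -
    have "u \<in> hom J (src J u) (tgt J u)"
      using u by (simp add: hom_def)
    from F.amap_cmp[OF \<pi>[OF K.S.src_obj[OF u]] K.amap_hom[OF this]] show ?thesis
      by (simp only: comm[OF u])
  qed
  then show ?thesis
    using F.omap_obj[OF L] F.amap_hom[OF \<pi>] by (simp add: cone_def ftor_comp_def)
qed

text \<open>The complex \<open>edge_pair x y x' y'\<close> consists of two disjoint edges \<open>{x, y}\<close> and \<open>{x', y'}\<close>
  interchanged by the involution. Equivariant maps out of it are simplices \<open>{a, b}\<close>, so it
  detects both the vertices and the adjacency relation of \<open>csorba_graph K\<close>.\<close>

definition edge_pair :: "'u \<Rightarrow> 'u \<Rightarrow> 'u \<Rightarrow> 'u \<Rightarrow> 'u z2_complex" where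
  "edge_pair x y x' y' = \<lparr>
     simplices = {\<sigma>. \<sigma> \<noteq> {} \<and> (\<sigma> \<subseteq> {x, y} \<or> \<sigma> \<subseteq> {x', y'})},
     invol = (\<lambda>v\<in>{x, y, x', y'}. if v = x then x' else if v = y then y' else if v = x' then x else y)\<rparr>"

text \<open>Equivariance forces the values on \<open>x'\<close> and \<open>y'\<close>, so
  \<open>a\<close> and \<open>b\<close> are the only data. The case \<open>a = b\<close> is allowed
  and encodes a vertex.\<close>

definition edge_pair_map ::
    "'u \<Rightarrow> 'u \<Rightarrow> 'u \<Rightarrow> 'u \<Rightarrow> 'u z2_complex \<Rightarrow> 'u \<Rightarrow> 'u \<Rightarrow> 'u \<Rightarrow> 'u" where
  "edge_pair_map x y x' y' K a b = (\<lambda>v\<in>{x, y, x', y'}.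
     if v = x then a else if v = y then b else if v = x' then invol K a else invol K b)"

lemma vertices_edge_pair [simp]: "vertices (edge_pair x y x' y') = {x, y, x', y'}"
  by (auto simp: vertices_def edge_pair_def)

lemma edge_pair_finite:
  assumes "distinct [x, y, x', y']"
  shows "edge_pair x y x' y' \<in> finite_z2_complexes"
proof -
  have "simplices (edge_pair x y x' y') \<subseteq> Pow {x, y, x', y'}"
    by (auto simp: edge_pair_def)
  then have fin: "finite (simplices (edge_pair x y x' y'))"
    by (rule finite_subset) simp
  have "invol (edge_pair x y x' y') ` \<sigma> \<in> simplices (edge_pair x y x' y')"
    if "\<sigma> \<in> simplices (edge_pair x y x' y')" for \<sigma>
    using that assms by (auto simp: edge_pair_def)
  then have simp: "simplicial (edge_pair x y x' y') (edge_pair x y x' y') (invol (edge_pair x y x' y'))"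
    by (simp add: simplicial_def)
  have "finite \<sigma>" if "\<sigma> \<in> simplices (edge_pair x y x' y')" for \<sigma>
    using that by (auto simp: edge_pair_def intro: finite_subset)
  then have ne: "\<forall>\<sigma>\<in>simplices (edge_pair x y x' y'). finite \<sigma> \<and> \<sigma> \<noteq> {}"
    by (simp add: edge_pair_def)
  have sub: "\<forall>\<sigma>\<in>simplices (edge_pair x y x' y'). \<forall>\<tau>. \<tau> \<subseteq> \<sigma> \<and> \<tau> \<noteq> {} \<longrightarrow> \<tau> \<in> simplices (edge_pair x y x' y')"
    unfolding edge_pair_def by (simp, blast)
  have inv: "invol (edge_pair x y x' y') \<in> vertices (edge_pair x y x' y') \<rightarrow>\<^sub>E vertices (edge_pair x y x' y')"
      "\<forall>v\<in>vertices (edge_pair x y x' y'). invol (edge_pair x y x' y') (invol (edge_pair x y x' y') v) = v"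
    unfolding vertices_edge_pair using assms by (auto simp: edge_pair_def)
  show ?thesis
    unfolding finite_z2_complexes_def
    by (intro CollectI conjI fin ne sub simp inv)
qed

text \<open>Each simplex of the source lies in one of the two edges, whose images are
  \<open>{a, b}\<close> and its image under the involution; both are simplices, and so are their
  non-empty subsets.\<close>

lemma edge_pair_map_hom:
  assumes "distinct [x, y, x', y']" "K \<in> finite_z2_complexes" "{a, b} \<in> simplices K"
  shows "(edge_pair x y x' y', edge_pair_map x y x' y' K a b, K) \<in> hom Z2_Complexes (edge_pair x y x' y') K"
proof -
  let ?f = "edge_pair_map x y x' y' K a b"
  have ab: "a \<in> vertices K" "b \<in> vertices K"
    using simplex_vertex[OF assms(2,3)] by auto
  have "?f ` \<sigma> \<in> simplices K" if "\<sigma> \<in> simplices (edge_pair x y x' y')" for \<sigma>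
  proof -
    have "\<sigma> \<noteq> {}" "\<sigma> \<subseteq> {x, y} \<or> \<sigma> \<subseteq> {x', y'}"
      using that by (auto simp: edge_pair_def)
    moreover have "?f ` {x, y} = {a, b}" "?f ` {x', y'} = {invol K a, invol K b}"
      using assms(1) by (auto simp: edge_pair_map_def)
    ultimately have "?f ` \<sigma> \<noteq> {}" "?f ` \<sigma> \<subseteq> {a, b} \<or> ?f ` \<sigma> \<subseteq> {invol K a, invol K b}"
      by (simp, metis image_mono)
    then show ?thesis
      using simplex_subset[OF assms(2)] assms(3) invol_simplex[OF assms(2,3)] by auto
  qed
  moreover have "?f (invol (edge_pair x y x' y') v) = invol K (?f v)" if "v \<in> {x, y, x', y'}" for v
    using that assms(1) invol_invol[OF assms(2)] ab by (auto simp: edge_pair_map_def edge_pair_def)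
  moreover have "?f \<in> {x, y, x', y'} \<rightarrow>\<^sub>E vertices K"
    using ab invol_vertex[OF assms(2)] by (auto simp: edge_pair_map_def)
  ultimately show ?thesis
    using edge_pair_finite assms(1,2)
    by (simp add: hom_Z2_Complexes z2_simplicial_def simplicial_def)
qed

text \<open>The correspondence between equivariant maps and pairs is natural, as equivariance takes
  care of the points \<open>x'\<close> and \<open>y'\<close>. Hence compatible families of pairs are
  cones with an edge pair as apex.\<close>

lemma cmp_edge_pair_map:
  assumes "(K, f, L) \<in> hom Z2_Complexes K L" "a \<in> vertices K" "b \<in> vertices K"
  shows "cmp Z2_Complexes (K, f, L) (edge_pair x y x' y', edge_pair_map x y x' y' K a b, K) =
    (edge_pair x y x' y', edge_pair_map x y x' y' L (f a) (f b), L)"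
proof -
  have "z2_simplicial K L f"
    using assms(1) by (auto simp: hom_Z2_Complexes)
  then show ?thesis
    using z2_simplicial_invol[of K L f] assms(2,3) by (auto simp: edge_pair_map_def compose_def)
qed

section \<open>Vertices and simplices of a limit complex\<close>

lemma hom_Z2_Complexes_umap:
  "a \<in> hom Z2_Complexes K L \<Longrightarrow> a = (K, umap a, L)"
  by (auto simp: hom_Z2_Complexes)

text \<open>The universal property is tested with the edge pair as apex: its uniqueness part
  separates the vertices of \<open>L\<close>, its existence part lifts a compatible family of
  simplices.\<close>

lemma
  fixes J :: "('i, 'j) cat" and K :: "('i, 'j, 'u z2_complex, ('u z2_complex, 'u) carrow) ftor"
  assumes inf: "infinite (UNIV :: 'u set)"
    and K: "cat_functor J Z2_Complexes K" and lim: "limit_cone J Z2_Complexes K L \<pi>"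
  shows limit_cone_vertex_eq: "\<lbrakk>v \<in> vertices L; w \<in> vertices L;
        \<And>i. i \<in> obj J \<Longrightarrow> umap (\<pi> i) v = umap (\<pi> i) w\<rbrakk> \<Longrightarrow> v = w"
    and limit_cone_simplex_ex: "\<lbrakk>\<And>i. i \<in> obj J \<Longrightarrow> {a i, b i} \<in> simplices (omap K i);
        \<And>u. u \<in> arr J \<Longrightarrow> umap (amap K u) (a (src J u)) = a (tgt J u);
        \<And>u. u \<in> arr J \<Longrightarrow> umap (amap K u) (b (src J u)) = b (tgt J u)\<rbrakk> \<Longrightarrow>
      \<exists>v w. {v, w} \<in> simplices L \<and> (\<forall>i\<in>obj J. umap (\<pi> i) v = a i \<and> umap (\<pi> i) w = b i)"
proof -
  interpret K: cat_functor J Z2_Complexes K by fact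
  \<comment> \<open>The test complex needs four distinct points in \<open>'u\<close>.\<close>
  obtain B :: "'u set" where "card B = 4" "finite B"
    using infinite_arbitrarily_large[OF inf] by blast
  then obtain l where "set l = B" "distinct l" "length l = 4"
    by (metis finite_distinct_list distinct_card)
  then obtain x y x' y' :: 'u where dist: "distinct [x, y, x', y']"
    by (auto simp: length_Suc_conv numeral_eq_Suc)
  let ?Q = "edge_pair x y x' y'" and ?q = "edge_pair_map x y x' y'"
  have cone: "cone J Z2_Complexes K L \<pi>"
    using lim by (simp add: limit_cone_def)
  have ex1: "\<exists>!h. h \<in> hom Z2_Complexes M L \<and> (\<forall>i\<in>obj J. cmp Z2_Complexes (\<pi> i) h = \<rho> i)"
      if "cone J Z2_Complexes K M \<rho>" for M \<rho>
    using lim that by (simp add: limit_cone_def)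
  have L: "L \<in> finite_z2_complexes" and \<pi>: "\<And>i. i \<in> obj J \<Longrightarrow> \<pi> i \<in> hom Z2_Complexes L (omap K i)"
    and comm: "\<And>u. u \<in> arr J \<Longrightarrow> cmp Z2_Complexes (amap K u) (\<pi> (src J u)) = \<pi> (tgt J u)"
    using cone by (auto simp: cone_def)
  have Ki: "omap K i \<in> finite_z2_complexes" if "i \<in> obj J" for i
    using K.omap_obj[OF that] by simp
  have Ku: "amap K u \<in> hom Z2_Complexes (omap K (src J u)) (omap K (tgt J u))" if "u \<in> arr J" for u
    using K.amap_hom[of u] that by (simp add: hom_def)
  have Qcone: "cone J Z2_Complexes K ?Q (\<lambda>i. (?Q, ?q (omap K i) (a i) (b i), omap K i))"
    if ab: "\<And>i. i \<in> obj J \<Longrightarrow> {a i, b i} \<in> simplices (omap K i)"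
      "\<And>u. u \<in> arr J \<Longrightarrow> umap (amap K u) (a (src J u)) = a (tgt J u)"
      "\<And>u. u \<in> arr J \<Longrightarrow> umap (amap K u) (b (src J u)) = b (tgt J u)" for a b
  proof -
    have "cmp Z2_Complexes (amap K u) (?Q, ?q (omap K (src J u)) (a (src J u)) (b (src J u)), omap K (src J u)) =
       (?Q, ?q (omap K (tgt J u)) (a (tgt J u)) (b (tgt J u)), omap K (tgt J u))" if u: "u \<in> arr J" for u
    proof -
      have src: "src J u \<in> obj J"
        by (rule K.S.src_obj[OF u])
      have "a (src J u) \<in> vertices (omap K (src J u))" "b (src J u) \<in> vertices (omap K (src J u))"
        using simplex_vertex[OF Ki[OF src] ab(1)[OF src]] by auto
      with cmp_edge_pair_map[of "omap K (src J u)" "umap (amap K u)" "omap K (tgt J u)"]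
      show ?thesis
        using hom_Z2_Complexes_umap[OF Ku[OF u]] Ku[OF u] ab(2,3)[OF u] by metis
    qed
    then show ?thesis
      using edge_pair_finite[OF dist] edge_pair_map_hom[OF dist Ki ab(1)]
      by (simp add: cone_def)
  qed
  have \<pi>Q: "cmp Z2_Complexes (\<pi> i) (?Q, ?q L v w, L) =
      (?Q, ?q (omap K i) (umap (\<pi> i) v) (umap (\<pi> i) w), omap K i)"
    if "i \<in> obj J" "v \<in> vertices L" "w \<in> vertices L" for i v w
    using cmp_edge_pair_map[of L "umap (\<pi> i)" "omap K i" v w] \<pi>[OF that(1)]
      hom_Z2_Complexes_umap[OF \<pi>[OF that(1)]] that(2,3) by metis
  show "v = w" if v: "v \<in> vertices L" and w: "w \<in> vertices L"
    and eq: "\<And>i. i \<in> obj J \<Longrightarrow> umap (\<pi> i) v = umap (\<pi> i) w"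
  proof -
    \<comment> \<open>A vertex \<open>z\<close> enters as the degenerate simplex
      \<open>{z, z}\<close>.\<close>
    have Qv: "(?Q, ?q L z z, L) \<in> hom Z2_Complexes ?Q L" if "z \<in> vertices L" for z
      using edge_pair_map_hom[OF dist L, of z z] that by (simp add: vertices_def)
    \<comment> \<open>As \<open>v\<close> and \<open>w\<close> have the same projections, the two
      maps that they define mediate the same cone and must coincide.\<close>
    define \<rho> where "\<rho> i = cmp Z2_Complexes (\<pi> i) (?Q, ?q L v v, L)" for i
    have "cone J Z2_Complexes K ?Q \<rho>"
      unfolding cone_def
    proof (intro conjI ballI)
      show "?Q \<in> obj Z2_Complexes"
        using edge_pair_finite[OF dist] by simp
      show "\<rho> i \<in> hom Z2_Complexes ?Q (omap K i)" if "i \<in> obj J" for i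
        unfolding \<rho>_def by (rule K.T.cmp_hom[OF Qv[OF v] \<pi>[OF that]])
      show "cmp Z2_Complexes (amap K u) (\<rho> (src J u)) = \<rho> (tgt J u)" if u: "u \<in> arr J" for u
        unfolding \<rho>_def K.T.cmp_assoc[OF Qv[OF v] \<pi>[OF K.S.src_obj[OF u]] Ku[OF u]] comm[OF u] ..
    qed
    then have "\<exists>!h. h \<in> hom Z2_Complexes ?Q L \<and> (\<forall>i\<in>obj J. cmp Z2_Complexes (\<pi> i) h = \<rho> i)"
      by (rule ex1)
    moreover have "\<forall>i\<in>obj J. cmp Z2_Complexes (\<pi> i) (?Q, ?q L w w, L) = \<rho> i"
      using \<pi>Q v w eq by (simp add: \<rho>_def)
    ultimately have "(?Q, ?q L v v, L) = (?Q, ?q L w w, L)"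
      using Qv[OF v] Qv[OF w] \<rho>_def by auto
    then have "?q L v v x = ?q L w w x"
      by simp
    then show ?thesis
      by (simp add: edge_pair_map_def)
  qed
  show "\<exists>v w. {v, w} \<in> simplices L \<and> (\<forall>i\<in>obj J. umap (\<pi> i) v = a i \<and> umap (\<pi> i) w = b i)"
    if a: "\<And>i. i \<in> obj J \<Longrightarrow> {a i, b i} \<in> simplices (omap K i)"
      "\<And>u. u \<in> arr J \<Longrightarrow> umap (amap K u) (a (src J u)) = a (tgt J u)"
      "\<And>u. u \<in> arr J \<Longrightarrow> umap (amap K u) (b (src J u)) = b (tgt J u)" for a b
  proof -
    obtain h where h: "h \<in> hom Z2_Complexes ?Q L"
      "\<forall>i\<in>obj J. cmp Z2_Complexes (\<pi> i) h = (?Q, ?q (omap K i) (a i) (b i), omap K i)"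
      using ex1[OF Qcone[OF a]] by blast
    then obtain g where g: "h = (?Q, g, L)" "z2_simplicial ?Q L g"
      by (auto simp: hom_Z2_Complexes)
    \<comment> \<open>The lift is the image of this edge under the mediating map.\<close>
    have "{x, y} \<in> simplices ?Q"
      by (simp add: edge_pair_def)
    from z2_simplicial_image[OF g(2) this] have "{g x, g y} \<in> simplices L"
      by simp
    moreover have "umap (\<pi> i) (g x) = a i \<and> umap (\<pi> i) (g y) = b i" if i: "i \<in> obj J" for i
    proof -
      have "cmp Z2_Complexes (L, umap (\<pi> i), omap K i) (?Q, g, L) =
          (?Q, ?q (omap K i) (a i) (b i), omap K i)"
        using h(2) i hom_Z2_Complexes_umap[OF \<pi>[OF i]] g(1) by simp
      then have "compose {x, y, x', y'} (umap (\<pi> i)) g = ?q (omap K i) (a i) (b i)"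
        by simp
      from fun_cong[OF this, of x] fun_cong[OF this, of y] show ?thesis
        using dist by (auto simp: compose_def edge_pair_map_def)
    qed
    ultimately show ?thesis
      by blast
  qed
qed

text \<open>The apex \<open>M\<close> of a competing cone is an arbitrary graph, so the universal
  property of \<open>L\<close> cannot be applied to it directly. But \<open>csorba\<close> keeps
  vertices and underlying maps, so a mediating map can be given pointwise: the family
  \<open>r i m\<close> lifts to a unique vertex of \<open>L\<close>, and an adjacency lifts as a
  simplex.\<close>

lemma csorba_preserves_limits:
  fixes J :: "('i, 'j) cat"
  assumes inf: "infinite (UNIV :: 'u set)"
  shows "preserves_limits_of_shape J Z2_Complexes Graphs (csorba :: ('u z2_complex, _, _, _) ftor)"
  unfolding preserves_limits_of_shape_def
proof (intro allI impI)
  fix K :: "('i, 'j, 'u z2_complex, ('u z2_complex, 'u) carrow) ftor" and L \<pi>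
  assume "cat_functor J Z2_Complexes K \<and> limit_cone J Z2_Complexes K L \<pi>"
  then have K: "cat_functor J Z2_Complexes K" and lim: "limit_cone J Z2_Complexes K L \<pi>"
    by auto
  interpret K: cat_functor J Z2_Complexes K by fact
  note vertex_eq = limit_cone_vertex_eq[OF inf K lim]
    and simplex_ex = limit_cone_simplex_ex[OF inf K lim]
  have cone: "cone J Z2_Complexes K L \<pi>"
    using lim by (simp add: limit_cone_def)
  have L: "L \<in> finite_z2_complexes" and \<pi>: "\<And>i. i \<in> obj J \<Longrightarrow> \<pi> i \<in> hom Z2_Complexes L (omap K i)"
    using cone by (auto simp: cone_def)
  define p where "p i = umap (\<pi> i)" for i
  have p: "\<pi> i = (L, p i, omap K i)" "p i \<in> vertices L \<rightarrow>\<^sub>E vertices (omap K i)"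
      "z2_simplicial L (omap K i) (p i)" if "i \<in> obj J" for i
    using \<pi>[OF that] by (auto simp: hom_Z2_Complexes p_def)
  define k where "k u = umap (amap K u)" for u
  have Ku: "amap K u \<in> hom Z2_Complexes (omap K (src J u)) (omap K (tgt J u))" if "u \<in> arr J" for u
    using K.amap_hom[of u] that by (simp add: hom_def)
  have k: "amap K u = (omap K (src J u), k u, omap K (tgt J u))"
      "z2_simplicial (omap K (src J u)) (omap K (tgt J u)) (k u)" if "u \<in> arr J" for u
    using Ku[OF that] by (auto simp: hom_Z2_Complexes k_def)
  have Ki: "omap K i \<in> finite_z2_complexes" if "i \<in> obj J" for i
    using K.omap_obj[OF that] by simp
  show "limit_cone J Graphs (ftor_comp csorba K) (omap csorba L) (\<lambda>i. amap csorba (\<pi> i))"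
    unfolding limit_cone_def
  proof (intro conjI allI impI)
    show "cone J Graphs (ftor_comp csorba K) (omap csorba L) (\<lambda>i. amap csorba (\<pi> i))"
      by (rule cone_functor_image[OF cat_functor_csorba K cone])
    fix M \<rho> assume "cone J Graphs (ftor_comp csorba K) M \<rho>"
    then have M: "M \<in> finite_graphs"
      and \<rho>: "\<And>i. i \<in> obj J \<Longrightarrow> \<rho> i \<in> hom Graphs M (csorba_graph (omap K i))"
      and \<rho>_comm: "\<And>u. u \<in> arr J \<Longrightarrow> cmp Graphs (amap csorba (amap K u)) (\<rho> (src J u)) = \<rho> (tgt J u)"
      by (auto simp: cone_def ftor_comp_def)
    define r where "r i = umap (\<rho> i)" for i
    have r: "\<rho> i = (M, r i, csorba_graph (omap K i))" "r i \<in> verts M \<rightarrow>\<^sub>E vertices (omap K i)"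
        "graph_hom M (csorba_graph (omap K i)) (r i)" if "i \<in> obj J" for i
      using \<rho>[OF that] by (auto simp: hom_Graphs r_def)
    have r_vertex: "r i m \<in> vertices (omap K i)" if "i \<in> obj J" "m \<in> verts M" for i m
      using r(2)[OF that(1)] that(2) by (rule PiE_mem)
    have kr: "k u (r (src J u) m) = r (tgt J u) m" if u: "u \<in> arr J" and m: "m \<in> verts M" for u m
    proof -
      have "compose (verts M) (k u) (r (src J u)) = r (tgt J u)"
        using \<rho>_comm[OF u] r(1)[OF K.S.src_obj[OF u]] r(1)[OF K.S.tgt_obj[OF u]] k(1)[OF u] by simp
      from fun_cong[OF this, of m] m show ?thesis
        by (simp add: compose_def)
    qed
    have "\<exists>v. v \<in> vertices L \<and> (\<forall>i\<in>obj J. p i v = r i m)" if m: "m \<in> verts M" for m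
    proof -
      \<comment> \<open>With \<open>a i = b i = r i m\<close>, either member of the lifted simplex
        is the required vertex over \<open>m\<close>.\<close>
      have "\<exists>v w. {v, w} \<in> simplices L \<and> (\<forall>i\<in>obj J. umap (\<pi> i) v = r i m \<and> umap (\<pi> i) w = r i m)"
      proof (rule simplex_ex)
        show "{r i m, r i m} \<in> simplices (omap K i)" if "i \<in> obj J" for i
          using r_vertex[OF that m] by (simp add: vertices_def)
      qed (use kr m in \<open>simp_all add: k_def\<close>)
      then show ?thesis
        using simplex_vertex[OF L] by (fastforce simp: p_def)
    qed
    then obtain h0 where h0: "\<And>m. m \<in> verts M \<Longrightarrow> h0 m \<in> vertices L \<and> (\<forall>i\<in>obj J. p i (h0 m) = r i m)"
      by metis
    define h where "h = restrict h0 (verts M)"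
    have h: "h m \<in> vertices L" "\<And>i. i \<in> obj J \<Longrightarrow> p i (h m) = r i m" if "m \<in> verts M" for m
      using h0[OF that] that by (auto simp: h_def)
    have "graph_hom M (csorba_graph L) h"
      unfolding graph_hom_def
    proof (intro ballI, clarify)
      fix m m' assume e: "(m, m') \<in> edges M"
      then have m: "m \<in> verts M" "m' \<in> verts M"
        using M by (auto simp: finite_graphs_def)
      \<comment> \<open>Adjacency of \<open>r i m\<close> and \<open>r i m'\<close> says that these
        sets are simplices; equivariance of the maps \<open>k u\<close> makes their first members a
        compatible family.\<close>
      have "\<exists>v w. {v, w} \<in> simplices L \<and>
          (\<forall>i\<in>obj J. umap (\<pi> i) v = invol (omap K i) (r i m) \<and> umap (\<pi> i) w = r i m')"
      proof (rule simplex_ex)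
        show "{invol (omap K i) (r i m), r i m'} \<in> simplices (omap K i)" if "i \<in> obj J" for i
          using r(3)[OF that] e by (auto simp: graph_hom_def edges_csorba_graph)
        show "umap (amap K u) (invol (omap K (src J u)) (r (src J u) m)) =
            invol (omap K (tgt J u)) (r (tgt J u) m)" if u: "u \<in> arr J" for u
          using z2_simplicial_invol[OF k(2)[OF u] r_vertex[OF K.S.src_obj[OF u] m(1)]] kr[OF u m(1)]
          by (simp add: k_def)
        show "umap (amap K u) (r (src J u) m') = r (tgt J u) m'" if "u \<in> arr J" for u
          using kr[OF that m(2)] by (simp add: k_def)
      qed
      then obtain v w where vw: "{v, w} \<in> simplices L"
        "\<And>i. i \<in> obj J \<Longrightarrow> p i v = invol (omap K i) (r i m)" "\<And>i. i \<in> obj J \<Longrightarrow> p i w = r i m'"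
        by (auto simp: p_def)
      have vertex: "v \<in> vertices L" "w \<in> vertices L"
        using simplex_vertex[OF L vw(1)] by auto
      \<comment> \<open>The lifted \<open>v\<close> and \<open>w\<close> are a priori unrelated to
        \<open>h\<close>; equal projections identify them with \<open>invol L (h m)\<close> and
        \<open>h m'\<close>.\<close>
      have "p i (invol L (h m)) = invol (omap K i) (r i m)" if "i \<in> obj J" for i
        using z2_simplicial_invol[OF p(3)[OF that] h(1)[OF m(1)]] h(2)[OF m(1) that] by simp
      then have "v = invol L (h m)"
        using vertex_eq[OF vertex(1) invol_vertex[OF L h(1)[OF m(1)]]] vw(2) by (simp add: p_def)
      moreover have "w = h m'"
        using vertex_eq[OF vertex(2) h(1)[OF m(2)]] vw(3) h(2)[OF m(2)] by (simp add: p_def)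
      ultimately show "(h m, h m') \<in> edges (csorba_graph L)"
        using vw(1) h(1) m by (simp add: edges_csorba_graph)
    qed
    then have hom: "(M, h, csorba_graph L) \<in> hom Graphs M (omap csorba L)"
      using M csorba_graph_finite[OF L] h(1) by (auto simp: hom_Graphs h_def)
    show "\<exists>!h. h \<in> hom Graphs M (omap csorba L) \<and> (\<forall>i\<in>obj J. cmp Graphs (amap csorba (\<pi> i)) h = \<rho> i)"
    proof (rule ex1I[of _ "(M, h, csorba_graph L)"])
      have "compose (verts M) (p i) h = r i" if i: "i \<in> obj J" for i
        using h(2)[OF _ i] r(2)[OF i] by (auto simp: compose_def fun_eq_iff PiE_iff extensional_def)
      then show "(M, h, csorba_graph L) \<in> hom Graphs M (omap csorba L) \<and>
          (\<forall>i\<in>obj J. cmp Graphs (amap csorba (\<pi> i)) (M, h, csorba_graph L) = \<rho> i)"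
        using hom p(1) r(1) by simp
      fix a assume a: "a \<in> hom Graphs M (omap csorba L) \<and> (\<forall>i\<in>obj J. cmp Graphs (amap csorba (\<pi> i)) a = \<rho> i)"
      then obtain f where f: "a = (M, f, csorba_graph L)" "f \<in> verts M \<rightarrow>\<^sub>E vertices L"
        by (auto simp: hom_Graphs)
      have "p i (f m) = r i m" if i: "i \<in> obj J" and m: "m \<in> verts M" for i m
      proof -
        have "compose (verts M) (p i) f = r i"
          using a f(1) p(1)[OF i] r(1)[OF i] i by auto
        from fun_cong[OF this, of m] m show ?thesis
          by (simp add: compose_def)
      qed
      then have "f m = h m" if "m \<in> verts M" for m
        using vertex_eq[OF PiE_mem[OF f(2) that] h(1)[OF that]] h(2) that by (simp add: p_def)
      then have "f = h"
        using f(2) by (auto simp: fun_eq_iff h_def PiE_iff extensional_def)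
      then show "a = (M, h, csorba_graph L)"
        using f(1) by simp
    qed
  qed
qed

section \<open>The right adjoint\<close>

text \<open>Up to isomorphism, \<open>K\<close> is the complex with vertex set \<open>edges G\<close> in which a set \<open>\<sigma>\<close> of edges is
  a simplex iff \<open>fst ` \<sigma> \<times> snd ` \<sigma> \<subseteq> edges G\<close>, with the reversal of edges as involution and with
  \<open>\<epsilon> = fst\<close>. It cannot be required to be equal to it, as its vertices have the type \<open>'u\<close>.\<close>

definition edge_model :: "'u graph \<Rightarrow> 'u z2_complex \<Rightarrow> ('u \<Rightarrow> 'u) \<Rightarrow> bool" where
  "edge_model G K \<epsilon> \<longleftrightarrow> K \<in> finite_z2_complexes \<and> \<epsilon> \<in> vertices K \<rightarrow>\<^sub>E verts G \<and>
     bij_betw (\<lambda>v. (\<epsilon> v, \<epsilon> (invol K v))) (vertices K) (edges G) \<and>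
     (\<forall>\<sigma>. \<sigma> \<in> simplices K \<longleftrightarrow> \<sigma> \<noteq> {} \<and> \<sigma> \<subseteq> vertices K \<and>
        (\<forall>v\<in>\<sigma>. \<forall>w\<in>\<sigma>. (\<epsilon> v, \<epsilon> (invol K w)) \<in> edges G))"

lemma
  assumes "edge_model G K \<epsilon>"
  shows edge_model_complex: "K \<in> finite_z2_complexes"
    and edge_model_map: "\<epsilon> \<in> vertices K \<rightarrow>\<^sub>E verts G"
    and edge_model_bij: "bij_betw (\<lambda>v. (\<epsilon> v, \<epsilon> (invol K v))) (vertices K) (edges G)"
    and edge_model_simplex_iff: "\<sigma> \<in> simplices K \<longleftrightarrow> \<sigma> \<noteq> {} \<and> \<sigma> \<subseteq> vertices K \<and>
        (\<forall>v\<in>\<sigma>. \<forall>w\<in>\<sigma>. (\<epsilon> v, \<epsilon> (invol K w)) \<in> edges G)"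
proof -
  note m = assms[unfolded edge_model_def]
  show "K \<in> finite_z2_complexes" "\<epsilon> \<in> vertices K \<rightarrow>\<^sub>E verts G"
    "bij_betw (\<lambda>v. (\<epsilon> v, \<epsilon> (invol K v))) (vertices K) (edges G)"
    by (rule m[THEN conjunct1] m[THEN conjunct2, THEN conjunct1]
        m[THEN conjunct2, THEN conjunct2, THEN conjunct1])+
  show "\<sigma> \<in> simplices K \<longleftrightarrow> \<sigma> \<noteq> {} \<and> \<sigma> \<subseteq> vertices K \<and>
      (\<forall>v\<in>\<sigma>. \<forall>w\<in>\<sigma>. (\<epsilon> v, \<epsilon> (invol K w)) \<in> edges G)"
    by (rule m[THEN conjunct2, THEN conjunct2, THEN conjunct2, THEN spec])
qed

lemma edge_model_vertex_eqI:
  assumes m: "edge_model G K \<epsilon>" and "v \<in> vertices K" "w \<in> vertices K"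
    and "\<epsilon> v = \<epsilon> w" "\<epsilon> (invol K v) = \<epsilon> (invol K w)"
  shows "v = w"
  using inj_onD[OF bij_betw_imp_inj_on[OF edge_model_bij[OF m]] _ assms(2,3)] assms(4,5) by simp

text \<open>The edges are coded by a set \<open>B\<close> of as many elements of \<open>'u\<close>,
  and the structure on edges is transported along the decoding \<open>d\<close> from
  \<open>B\<close> to \<open>edges G\<close>.\<close>

lemma edge_model_exists:
  fixes G :: "'u graph"
  assumes inf: "infinite (UNIV :: 'u set)" and G: "G \<in> finite_graphs"
  shows "\<exists>K \<epsilon>. edge_model G K \<epsilon>"
proof -
  have subset: "edges G \<subseteq> verts G \<times> verts G" and sym: "sym (edges G)" and "finite (verts G)"
    using G by (auto simp: finite_graphs_def)
  then have fin: "finite (edges G)"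
    by (meson finite_SigmaI finite_subset)
  obtain B :: "'u set" where "finite B" "card B = card (edges G)"
    using infinite_arbitrarily_large[OF inf] by blast
  then obtain e where e: "bij_betw e (edges G) B"
    using finite_same_card_bij[OF fin] by metis
  define d where "d = inv_into (edges G) e"
  have d: "d v \<in> edges G" "e (d v) = v" if "v \<in> B" for v
    using that e bij_betwE[OF bij_betw_inv_into[OF e]] bij_betw_inv_into_right[OF e]
    by (auto simp: d_def)
  have de: "e p \<in> B" "d (e p) = p" if "p \<in> edges G" for p
    using that bij_betwE[OF e] bij_betw_inv_into_left[OF e] by (auto simp: d_def)
  define K where "K = \<lparr>simplices = {\<sigma>. \<sigma> \<noteq> {} \<and> \<sigma> \<subseteq> B \<and> (\<forall>v\<in>\<sigma>. \<forall>w\<in>\<sigma>. (fst (d v), snd (d w)) \<in> edges G)},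
    invol = (\<lambda>v\<in>B. e (prod.swap (d v)))\<rparr>"
  define \<epsilon> where "\<epsilon> = (\<lambda>v\<in>B. fst (d v))"
  have vert: "vertices K = B"
    using d(1) by (auto simp: vertices_def K_def)
  have swap: "prod.swap p \<in> edges G" if "p \<in> edges G" for p
    using sym that by (cases p) (auto simp: sym_def)
  have invol: "invol K v \<in> B" "d (invol K v) = prod.swap (d v)" if "v \<in> B" for v
    using de[OF swap[OF d(1)[OF that]]] that by (simp_all add: K_def)
  have involinvol: "invol K (invol K v) = v" if "v \<in> B" for v
  proof -
    have "invol K (invol K v) = e (d (invol K (invol K v)))"
      using d(2) invol(1) that by simp
    also have "\<dots> = v"
      using d(2) invol that by simp
    finally show ?thesis .
  qed
  have simp: "\<sigma> \<in> simplices K \<longleftrightarrow> \<sigma> \<noteq> {} \<and> \<sigma> \<subseteq> B \<and> (\<forall>v\<in>\<sigma>. \<forall>w\<in>\<sigma>. (fst (d v), snd (d w)) \<in> edges G)" for \<sigma>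
    by (simp add: K_def)
  have "K \<in> finite_z2_complexes"
    unfolding finite_z2_complexes_def
  proof (intro CollectI conjI ballI allI impI)
    have "simplices K \<subseteq> Pow B"
      using simp by blast
    with \<open>finite B\<close> show "finite (simplices K)"
      by (simp add: finite_subset)
    show "finite \<sigma>" "\<sigma> \<noteq> {}" if "\<sigma> \<in> simplices K" for \<sigma>
      using that simp \<open>finite B\<close> finite_subset by blast+
    show "\<tau> \<in> simplices K" if "\<sigma> \<in> simplices K" "\<tau> \<subseteq> \<sigma> \<and> \<tau> \<noteq> {}" for \<sigma> \<tau>
      using that unfolding simp by blast
    show "invol K \<in> vertices K \<rightarrow>\<^sub>E vertices K"
      using invol(1) by (auto simp: vert) (simp add: K_def)
    show "simplicial K K (invol K)"
      unfolding simplicial_def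
    proof
      fix \<sigma> assume \<sigma>: "\<sigma> \<in> simplices K"
      \<comment> \<open>Reversal exchanges the two ends, so the condition for \<open>v\<close>,
        \<open>w\<close> becomes the one for \<open>w\<close>, \<open>v\<close> read backwards, and
        \<open>edges G\<close> is symmetric.\<close>
      have "(fst (d (invol K v)), snd (d (invol K w))) \<in> edges G" if "v \<in> \<sigma>" "w \<in> \<sigma>" for v w
      proof -
        have "v \<in> B" "w \<in> B" "(fst (d w), snd (d v)) \<in> edges G"
          using that \<sigma> unfolding simp by auto
        then show ?thesis
          using swap[of "(fst (d w), snd (d v))"] invol(2) by simp
      qed
      moreover have "\<sigma> \<noteq> {}" "invol K ` \<sigma> \<subseteq> B"
        using \<sigma> invol(1) unfolding simp by auto
      ultimately show "invol K ` \<sigma> \<in> simplices K"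
        unfolding simp by simp
    qed
    show "invol K (invol K v) = v" if "v \<in> vertices K" for v
      using involinvol that by (simp add: vert)
  qed
  moreover have \<epsilon>: "\<epsilon> v = fst (d v)" "\<epsilon> (invol K v) = snd (d v)" if "v \<in> B" for v
    using that invol by (simp_all add: \<epsilon>_def)
  \<comment> \<open>On codes, the map in \<open>edge_model\<close> is just decoding.\<close>
  have "bij_betw (\<lambda>v. (\<epsilon> v, \<epsilon> (invol K v))) B (edges G) \<longleftrightarrow> bij_betw d B (edges G)"
    by (rule bij_betw_cong) (simp add: \<epsilon>)
  moreover have "bij_betw d B (edges G)"
    using bij_betw_inv_into[OF e] by (simp add: d_def)
  moreover have "\<epsilon> \<in> B \<rightarrow>\<^sub>E verts G"
    using d(1) subset by (fastforce simp: \<epsilon>_def)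
  moreover have "\<sigma> \<in> simplices K \<longleftrightarrow> \<sigma> \<noteq> {} \<and> \<sigma> \<subseteq> B \<and> (\<forall>v\<in>\<sigma>. \<forall>w\<in>\<sigma>. (\<epsilon> v, \<epsilon> (invol K w)) \<in> edges G)" for \<sigma>
  proof (cases "\<sigma> \<subseteq> B")
    case True
    then have "(\<forall>v\<in>\<sigma>. \<forall>w\<in>\<sigma>. (\<epsilon> v, \<epsilon> (invol K w)) \<in> edges G) \<longleftrightarrow>
        (\<forall>v\<in>\<sigma>. \<forall>w\<in>\<sigma>. (fst (d v), snd (d w)) \<in> edges G)"
      using \<epsilon> by (intro ball_cong refl) (simp add: subset_iff)
    then show ?thesis
      unfolding simp by simp
  next
    case False
    then show ?thesis
      unfolding simp by simp
  qed
  ultimately have "edge_model G K \<epsilon>"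
    unfolding edge_model_def vert by simp
  then show ?thesis by blast
qed

text \<open>Uniqueness comes from equivariance: \<open>\<epsilon>\<close> fixes only the first end
  of \<open>k v\<close>, but the second end is the first end of \<open>k (invol X v)\<close>.
  Existence comes from \<open>{v}\<close> being a simplex, which makes \<open>v\<close> adjacent to
  \<open>invol X v\<close> in the Csorba graph, so that the required edge is there.\<close>

lemma edge_model_universal:
  assumes G: "G \<in> finite_graphs" and m: "edge_model G K \<epsilon>"
  shows "universal_arrow Z2_Complexes Graphs csorba G K (csorba_graph K, \<epsilon>, G)"
  unfolding universal_arrow_def
proof (intro conjI ballI)
  note K = edge_model_complex[OF m] and \<epsilon> = edge_model_map[OF m] and bij = edge_model_bij[OF m]
    and simplex_iff = edge_model_simplex_iff[OF m]
  show "K \<in> obj Z2_Complexes"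
    using K by simp
  have sym: "(w, v) \<in> edges G" if "(v, w) \<in> edges G" for v w
    using G that by (auto simp: finite_graphs_def sym_def)
  have "(\<epsilon> v, \<epsilon> w) \<in> edges G" if v: "v \<in> vertices K" and vw: "{invol K v, w} \<in> simplices K" for v w
  proof -
    \<comment> \<open>The simplex condition is used for \<open>w\<close> and
      \<open>invol K v\<close>; the two involutions cancel.\<close>
    have "(\<epsilon> w, \<epsilon> (invol K (invol K v))) \<in> edges G"
      using vw unfolding simplex_iff by blast
    then show ?thesis
      using sym invol_invol[OF K v] by simp
  qed
  then have "graph_hom (csorba_graph K) G \<epsilon>"
    by (auto simp: graph_hom_def edges_csorba_graph)
  then show "(csorba_graph K, \<epsilon>, G) \<in> hom Graphs (omap csorba K) G"
    using G \<epsilon> csorba_graph_finite[OF K] by (simp add: hom_Graphs)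
  fix X and h :: "('a graph, 'a) carrow"
  assume "X \<in> obj Z2_Complexes" and "h \<in> hom Graphs (omap csorba X) G"
  then obtain f where X: "X \<in> finite_z2_complexes" and h: "h = (csorba_graph X, f, G)"
    and f: "f \<in> vertices X \<rightarrow>\<^sub>E verts G" and f_hom: "graph_hom (csorba_graph X) G f"
    by (auto simp: hom_Graphs)
  have f_edge: "(f (invol X v), f w) \<in> edges G" if "{v, w} \<in> simplices X" for v w
  proof -
    have v: "v \<in> vertices X" and w: "w \<in> vertices X"
      using simplex_vertex[OF X that] by auto
    then have "(invol X v, w) \<in> edges (csorba_graph X)"
      using that invol_invol[OF X v] invol_vertex[OF X v] by (simp add: edges_csorba_graph)
    then show ?thesis
      using f_hom by (auto simp: graph_hom_def)
  qed
  let ?c = "\<lambda>v. (\<epsilon> v, \<epsilon> (invol K v))"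
  define k where "k = (\<lambda>v\<in>vertices X. inv_into (vertices K) ?c (f v, f (invol X v)))"
  have k: "k v \<in> vertices K" "\<epsilon> (k v) = f v" "\<epsilon> (invol K (k v)) = f (invol X v)"
    if v: "v \<in> vertices X" for v
  proof -
    have "(f v, f (invol X v)) \<in> edges G"
      using sym[OF f_edge[of v v]] v by (simp add: vertices_def)
    then have *: "(f v, f (invol X v)) \<in> ?c ` vertices K"
      using bij_betw_imp_surj_on[OF bij] by simp
    show "k v \<in> vertices K"
      using inv_into_into[OF *] v by (simp add: k_def)
    show "\<epsilon> (k v) = f v" "\<epsilon> (invol K (k v)) = f (invol X v)"
      using f_inv_into_f[OF *] v by (simp_all add: k_def)
  qed
  have "k (invol X v) = invol K (k v)" if v: "v \<in> vertices X" for v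
  proof (rule edge_model_vertex_eqI[OF m])
    note X_inv = invol_vertex[OF X v]
    show "k (invol X v) \<in> vertices K" "invol K (k v) \<in> vertices K"
      using k(1) X_inv v invol_vertex[OF K] by auto
    show "\<epsilon> (k (invol X v)) = \<epsilon> (invol K (k v))"
      using k(2)[OF X_inv] k(3)[OF v] by simp
    show "\<epsilon> (invol K (k (invol X v))) = \<epsilon> (invol K (invol K (k v)))"
      using k(3)[OF X_inv] k(2)[OF v] invol_invol[OF X v] invol_invol[OF K k(1)[OF v]] by simp
  qed
  moreover have "k ` \<sigma> \<in> simplices K" if \<sigma>: "\<sigma> \<in> simplices X" for \<sigma>
    unfolding simplex_iff
  proof (intro conjI ballI)
    show "k ` \<sigma> \<noteq> {}" "k ` \<sigma> \<subseteq> vertices K"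
      using simplex_nonempty[OF X \<sigma>] simplex_vertex[OF X \<sigma>] k(1) by auto
    fix a b assume "a \<in> k ` \<sigma>" "b \<in> k ` \<sigma>"
    then obtain v w where vw: "v \<in> \<sigma>" "w \<in> \<sigma>" "a = k v" "b = k w"
      by blast
    \<comment> \<open>Written with \<open>w\<close> first because \<open>f_edge\<close> puts the
      involution on the first member; symmetry then moves it to the second place.\<close>
    then have "{w, v} \<in> simplices X"
      using simplex_subset[OF X \<sigma>] by simp
    from sym[OF f_edge[OF this]] show "(\<epsilon> a, \<epsilon> (invol K b)) \<in> edges G"
      using vw k simplex_vertex[OF X \<sigma>] by simp
  qed
  ultimately have k_hom: "(X, k, K) \<in> hom Z2_Complexes X K"
    using X K k(1) by (auto simp: hom_Z2_Complexes z2_simplicial_def simplicial_def k_def)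
  show "\<exists>!k. k \<in> hom Z2_Complexes X K \<and> cmp Graphs (csorba_graph K, \<epsilon>, G) (amap csorba k) = h"
  proof (rule ex1I[of _ "(X, k, K)"])
    have "compose (vertices X) \<epsilon> k = f"
      using k(2) f by (auto simp: fun_eq_iff compose_def PiE_iff extensional_def)
    then show "(X, k, K) \<in> hom Z2_Complexes X K \<and>
        cmp Graphs (csorba_graph K, \<epsilon>, G) (amap csorba (X, k, K)) = h"
      using k_hom h by simp
    fix a assume a: "a \<in> hom Z2_Complexes X K \<and> cmp Graphs (csorba_graph K, \<epsilon>, G) (amap csorba a) = h"
    then obtain l where l: "a = (X, l, K)" "l \<in> vertices X \<rightarrow>\<^sub>E vertices K" "z2_simplicial X K l"
      by (auto simp: hom_Z2_Complexes)
    then have comp: "compose (vertices X) \<epsilon> l = f"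
      using a h by simp
    have el: "\<epsilon> (l v) = f v" if "v \<in> vertices X" for v
      using fun_cong[OF comp, of v] that by (simp add: compose_def)
    have "l v = k v" if v: "v \<in> vertices X" for v
    proof (rule edge_model_vertex_eqI[OF m])
      show "l v \<in> vertices K" "k v \<in> vertices K"
        using PiE_mem[OF l(2) v] k(1)[OF v] .
      show "\<epsilon> (l v) = \<epsilon> (k v)"
        using el k(2) v by simp
      show "\<epsilon> (invol K (l v)) = \<epsilon> (invol K (k v))"
        using el[OF invol_vertex[OF X v]] k(3)[OF v] z2_simplicial_invol[OF l(3) v] by simp
    qed
    then have "l = k"
      using l(2) by (auto simp: fun_eq_iff k_def PiE_iff extensional_def)
    then show "a = (X, k, K)"
      using l(1) by simp
  qed
qed

text \<open>By uniqueness of universal arrows, \<open>K\<close> is isomorphic to an edge model, and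
  the defining conditions are invariant under equivariant isomorphisms compatible with the maps to
  \<open>G\<close>. This makes the description by edges available for every right adjoint.\<close>

lemma edge_model_if_universal:
  assumes inf: "infinite (UNIV :: 'u set)" and G: "(G :: 'u graph) \<in> finite_graphs"
    and u: "universal_arrow Z2_Complexes Graphs csorba G K e"
  shows "edge_model G K (umap e)"
proof -
  obtain K0 \<epsilon>0 where m: "edge_model G K0 \<epsilon>0"
    using edge_model_exists[OF inf G] by blast
  obtain a b where a: "a \<in> hom Z2_Complexes K0 K" and b: "b \<in> hom Z2_Complexes K K0"
    and eb: "cmp Graphs (csorba_graph K0, \<epsilon>0, G) (amap csorba b) = e"
    and ab: "cmp Z2_Complexes b a = ident Z2_Complexes K0" "cmp Z2_Complexes a b = ident Z2_Complexes K"
    using universal_arrow_unique[OF cat_functor_csorba edge_model_universal[OF G m] u] by metis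
  obtain f where f: "a = (K0, f, K)" "f \<in> vertices K0 \<rightarrow>\<^sub>E vertices K" "z2_simplicial K0 K f"
    using a by (auto simp: hom_Z2_Complexes)
  obtain g where g: "b = (K, g, K0)" "g \<in> vertices K \<rightarrow>\<^sub>E vertices K0" "z2_simplicial K K0 g"
    using b by (auto simp: hom_Z2_Complexes)
  have K: "K \<in> finite_z2_complexes" and K0: "K0 \<in> finite_z2_complexes"
    using b by (auto simp: hom_Z2_Complexes)
  obtain \<epsilon> where \<epsilon>: "e = (csorba_graph K, \<epsilon>, G)" "\<epsilon> \<in> vertices K \<rightarrow>\<^sub>E verts G"
    using u by (auto simp: universal_arrow_def hom_Graphs)
  have "compose (vertices K) \<epsilon>0 g = \<epsilon>"
    using eb g(1) \<epsilon>(1) by simp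
  then have \<epsilon>g: "\<epsilon> v = \<epsilon>0 (g v)" if "v \<in> vertices K" for v
    using that by (auto simp: compose_def)
  have "compose (vertices K) f g = (\<lambda>v\<in>vertices K. v)"
    using ab(2) f(1) g(1) by simp
  then have fg: "f (g v) = v" if "v \<in> vertices K" for v
    using that by (metis compose_eq restrict_apply')
  have "compose (vertices K0) g f = (\<lambda>v\<in>vertices K0. v)"
    using ab(1) f(1) g(1) by simp
  then have gf: "g (f v) = v" if "v \<in> vertices K0" for v
    using that by (metis compose_eq restrict_apply')
  have g_bij: "bij_betw g (vertices K) (vertices K0)"
    using fg gf PiE_mem[OF f(2)] PiE_mem[OF g(2)] by (intro bij_betw_byWitness[where f' = f]) auto
  have \<epsilon>g': "\<epsilon> (invol K v) = \<epsilon>0 (invol K0 (g v))" if "v \<in> vertices K" for v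
    using \<epsilon>g[OF invol_vertex[OF K that]] z2_simplicial_invol[OF g(3) that] by simp
  have "bij_betw ((\<lambda>v. (\<epsilon>0 v, \<epsilon>0 (invol K0 v))) \<circ> g) (vertices K) (edges G)"
    using bij_betw_trans[OF g_bij edge_model_bij[OF m]] .
  moreover have "bij_betw ((\<lambda>v. (\<epsilon>0 v, \<epsilon>0 (invol K0 v))) \<circ> g) (vertices K) (edges G) \<longleftrightarrow>
      bij_betw (\<lambda>v. (\<epsilon> v, \<epsilon> (invol K v))) (vertices K) (edges G)"
    by (rule bij_betw_cong) (simp add: \<epsilon>g \<epsilon>g')
  ultimately have "bij_betw (\<lambda>v. (\<epsilon> v, \<epsilon> (invol K v))) (vertices K) (edges G)"
    by simp
  moreover have "\<sigma> \<in> simplices K \<longleftrightarrow> \<sigma> \<noteq> {} \<and> \<sigma> \<subseteq> vertices K \<and>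
      (\<forall>v\<in>\<sigma>. \<forall>w\<in>\<sigma>. (\<epsilon> v, \<epsilon> (invol K w)) \<in> edges G)" for \<sigma>
  proof (cases "\<sigma> \<noteq> {} \<and> \<sigma> \<subseteq> vertices K")
    case True
    \<comment> \<open>The following equivalence uses that \<open>g\<close> is simplicial in one
      direction and that its inverse \<open>f\<close> is in the other.\<close>
    have "f ` g ` \<sigma> = \<sigma>"
      using fg True by (force simp: image_image)
    then have "\<sigma> \<in> simplices K \<longleftrightarrow> g ` \<sigma> \<in> simplices K0"
      using z2_simplicial_image[OF f(3), of "g ` \<sigma>"] z2_simplicial_image[OF g(3), of \<sigma>] by auto
    also have "\<dots> \<longleftrightarrow> (\<forall>v\<in>\<sigma>. \<forall>w\<in>\<sigma>. (\<epsilon>0 (g v), \<epsilon>0 (invol K0 (g w))) \<in> edges G)"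
      using True PiE_mem[OF g(2)] by (auto simp: edge_model_simplex_iff[OF m])
    also have "\<dots> \<longleftrightarrow> (\<forall>v\<in>\<sigma>. \<forall>w\<in>\<sigma>. (\<epsilon> v, \<epsilon> (invol K w)) \<in> edges G)"
      using True \<epsilon>g \<epsilon>g' by (intro ball_cong refl) (simp add: subset_iff)
    finally show ?thesis
      using True by simp
  next
    case False
    then show ?thesis
      using simplex_nonempty[OF K] simplex_vertex[OF K] by blast
  qed
  ultimately show ?thesis
    unfolding edge_model_def \<epsilon>(1) umap_simp using K \<epsilon>(2) by blast
qed

lemma csorba_right_adjoint:
  assumes inf: "infinite (UNIV :: 'u set)"
  shows "\<exists>R. adjunction Z2_Complexes Graphs (csorba :: ('u z2_complex, _, _, _) ftor) R"
proof (rule adjunction_if_universal_arrows[OF cat_functor_csorba])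
  fix G :: "'u graph" assume "G \<in> obj Graphs"
  then show "\<exists>K e. universal_arrow Z2_Complexes Graphs csorba G K e"
    using edge_model_exists[OF inf] edge_model_universal by (metis Graphs_simps(1))
qed

section \<open>Push-forward of distributions\<close>

lemma
  assumes "p \<in> prob_dists V"
  shows prob_dist_nonneg: "0 \<le> p v"
    and prob_dist_outside: "v \<notin> V \<Longrightarrow> p v = 0"
    and prob_dist_sum: "sum p V = 1"
  using assms by (auto simp: prob_dists_def)

lemma supp_subset: "p \<in> prob_dists V \<Longrightarrow> supp p \<subseteq> V"
  using prob_dist_outside by (fastforce simp: supp_def)

lemma supp_nonempty: "supp p \<noteq> {}" if "p \<in> prob_dists V"
proof
  assume "supp p = {}"
  then have "sum p V = 0"
    by (intro sum.neutral) (auto simp: supp_def)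
  then show False
    using prob_dist_sum[OF that] by simp
qed

lemma pushforward_in_prob_dists:
  assumes "finite V" "finite W" "f \<in> V \<rightarrow> W" "p \<in> prob_dists V"
  shows "pushforward V f p \<in> prob_dists W"
proof -
  have "sum (pushforward V f p) W = sum p V"
    unfolding pushforward_def using assms(1-3) by (intro sum.group) auto
  moreover have "pushforward V f p w = 0" if "w \<notin> W" for w
    unfolding pushforward_def using assms(3) that by (intro sum.neutral) auto
  ultimately show ?thesis
    using assms(4) by (auto simp: prob_dists_def pushforward_def intro!: sum_nonneg)
qed

text \<open>Weights are non-negative, so nothing cancels in a sum over a fibre.\<close>

lemma supp_pushforward:
  assumes "finite V" "p \<in> prob_dists V"
  shows "supp (pushforward V f p) = f ` supp p"
proof -
  have "pushforward V f p w = 0 \<longleftrightarrow> (\<forall>v\<in>V. f v = w \<longrightarrow> p v = 0)" for w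
    unfolding pushforward_def using assms(1) prob_dist_nonneg[OF assms(2)]
    by (subst sum_nonneg_eq_0_iff) auto
  then show ?thesis
    using supp_subset[OF assms(2)] by (auto simp: supp_def image_iff)
qed

lemma pushforward_cong: "(\<And>v. v \<in> V \<Longrightarrow> f v = g v) \<Longrightarrow> pushforward V f p = pushforward V g p"
  by (auto simp: pushforward_def intro!: ext sum.cong)

lemma pushforward_pushforward:
  assumes "finite V" "finite W" "f \<in> V \<rightarrow> W"
  shows "pushforward W g (pushforward V f p) = pushforward V (g \<circ> f) p"
proof
  fix u
  have "pushforward W g (pushforward V f p) u =
      (\<Sum>w | w \<in> W \<and> g w = u. sum p {v \<in> {v \<in> V. g (f v) = u}. f v = w})"
    unfolding pushforward_def by (intro sum.cong refl) auto
  also have "\<dots> = sum p {v \<in> V. g (f v) = u}"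
    using assms by (intro sum.group) auto
  finally show "pushforward W g (pushforward V f p) u = pushforward V (g \<circ> f) p u"
    by (simp add: pushforward_def)
qed

lemma pushforward_ident:
  assumes "p \<in> prob_dists V"
  shows "pushforward V (\<lambda>v\<in>V. v) p = p"
proof
  fix w
  have "{v \<in> V. (\<lambda>v\<in>V. v) v = w} = (if w \<in> V then {w} else {})"
    by auto
  then show "pushforward V (\<lambda>v\<in>V. v) p w = p w"
    using prob_dist_outside[OF assms] by (simp add: pushforward_def)
qed

text \<open>Fibres over points of \<open>V\<close> are singletons, so an involution acts on
  distributions by permuting coordinates. Hence it respects affine combinations, which is what makes
  a straight-line homotopy equivariant.\<close>

lemma pushforward_involution:
  assumes "\<And>v. v \<in> V \<Longrightarrow> i v \<in> V" "\<And>v. v \<in> V \<Longrightarrow> i (i v) = v"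
  shows "pushforward V i p w = (if w \<in> V then p (i w) else 0)"
proof -
  have "{v \<in> V. i v = w} = (if w \<in> V then {i w} else {})"
    using assms by auto
  then show ?thesis
    by (simp add: pushforward_def)
qed

lemma continuous_on_apply:
  fixes f :: "'a::topological_space \<Rightarrow> 'b \<Rightarrow> 'c::topological_space"
  assumes "continuous_on S f"
  shows "continuous_on S (\<lambda>x. f x i)"
  by (rule continuous_on_compose2[OF continuous_on_product_coordinates assms]) simp

lemma continuous_on_pushforward: "continuous_on S (pushforward V f)"
proof (rule continuous_on_coordinatewise_then_product)
  fix w
  show "continuous_on S (\<lambda>p. pushforward V f p w)"
    unfolding pushforward_def
    by (rule continuous_on_sum) (rule continuous_on_apply[OF continuous_on_id])
qed

section \<open>Realization and box complex as functors\<close>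

lemma hom_Z2_Spaces:
  "a \<in> hom Z2_Spaces X Y \<longleftrightarrow> X \<in> z2_spaces \<and> Y \<in> z2_spaces \<and>
     (\<exists>f. a = (X, f, Y) \<and> f \<in> topspace (topo X) \<rightarrow>\<^sub>E topspace (topo Y) \<and> z2_map X Y f)"
  by (simp add: Z2_Spaces_def hom_concrete_cat)

lemma Z2_Spaces_simps [simp]:
  "obj Z2_Spaces = z2_spaces"
  "ident Z2_Spaces X = (X, (\<lambda>x\<in>topspace (topo X). x), X)"
  "cmp Z2_Spaces (Y', g, Z) (X, f, Y) = (X, compose (topspace (topo X)) g f, Z)"
  by (simp_all add: Z2_Spaces_def)

lemma flip_mem: "X \<in> z2_spaces \<Longrightarrow> x \<in> topspace (topo X) \<Longrightarrow> flip X x \<in> topspace (topo X)"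
  by (auto simp: z2_spaces_def)

lemma category_Z2_Spaces: "category Z2_Spaces"
  unfolding Z2_Spaces_def
proof (rule category_concrete_cat)
  fix X :: "'a z2_space" assume X: "X \<in> z2_spaces"
  have "continuous_map (topo X) (topo X) (\<lambda>x\<in>topspace (topo X). x)"
    by (rule continuous_map_eq[OF continuous_map_id]) simp
  then show "z2_map X X (\<lambda>x\<in>topspace (topo X). x)"
    using flip_mem[OF X] by (simp add: z2_map_def equivariant_def)
next
  fix X Y Z :: "'a z2_space" and f g
  assume X: "X \<in> z2_spaces" and f: "z2_map X Y f" and g: "z2_map Y Z g"
  have "continuous_map (topo X) (topo Z) (g \<circ> f)"
    using f g continuous_map_compose by (auto simp: z2_map_def)
  then have "continuous_map (topo X) (topo Z) (compose (topspace (topo X)) g f)"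
    by (rule continuous_map_eq) (simp add: compose_def)
  moreover have "f x \<in> topspace (topo Y)" if "x \<in> topspace (topo X)" for x
    using f that continuous_map_funspace by (fastforce simp: z2_map_def)
  ultimately show "z2_map X Z (compose (topspace (topo X)) g f)"
    using f g flip_mem[OF X] by (simp add: z2_map_def equivariant_def compose_def)
qed

text \<open>Arrows of \<open>Z2_Spaces\<close> are extensional, so formulas enter as restrictions;
  continuity does not see the values outside \<open>A\<close>.\<close>

lemma continuous_map_restrict_top_of_set:
  "continuous_map (top_of_set A) (top_of_set B) (restrict f A) \<longleftrightarrow> continuous_on A f \<and> f \<in> A \<rightarrow> B"
  by (auto simp: Pi_iff cong: continuous_on_cong_simp)

lemma topspace_realization_space [simp]: "topspace (topo (realization_space K)) = realization_points K"
  by (simp add: realization_space_def)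

lemma topspace_box_space [simp]: "topspace (topo (box_space G)) = box_points G"
  by (simp add: box_space_def)

lemma flip_realization_space:
  "p \<in> realization_points K \<Longrightarrow> flip (realization_space K) p = pushforward (vertices K) (invol K) p"
  by (simp add: realization_space_def)

lemma flip_box_space: "(s, t) \<in> box_points G \<Longrightarrow> flip (box_space G) (s, t) = (t, s)"
  by (simp add: box_space_def)

lemma pushforward_realization_points:
  assumes K: "K \<in> finite_z2_complexes" and L: "L \<in> finite_z2_complexes"
    and f: "f \<in> vertices K \<rightarrow> vertices L" "simplicial K L f" and p: "p \<in> realization_points K"
  shows "pushforward (vertices K) f p \<in> realization_points L"
  using assms pushforward_in_prob_dists[OF finite_vertices[OF K] finite_vertices[OF L] f(1), of p]
    supp_pushforward[OF finite_vertices[OF K], of p f]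
  by (simp add: realization_points_def simplicial_def)

lemma realization_space_z2_space: "realization_space K \<in> z2_spaces" if K: "K \<in> finite_z2_complexes"
proof -
  let ?P = "pushforward (vertices K) (invol K)"
  have "simplicial K K (invol K)"
    using invol_simplex[OF K] by (simp add: simplicial_def)
  then have mem: "?P p \<in> realization_points K" if "p \<in> realization_points K" for p
    using pushforward_realization_points[OF K K _ _ that] invol_vertex[OF K] by auto
  have "?P (?P p) = p" if "p \<in> realization_points K" for p
  proof
    fix v
    have "p v = 0" if "v \<notin> vertices K"
      using prob_dist_outside that \<open>p \<in> realization_points K\<close> by (auto simp: realization_points_def)
    then show "?P (?P p) v = p v"
      using invol_vertex[OF K] invol_invol[OF K] by (simp add: pushforward_involution)
  qed
  then show ?thesis
    using mem unfolding z2_spaces_def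
    by (simp add: realization_space_def continuous_map_restrict_top_of_set continuous_on_pushforward
        del: continuous_map_subtopology_eu)
qed

lemma realization_hom:
  assumes "(K, f, L) \<in> hom Z2_Complexes K L"
  shows "amap realization (K, f, L) \<in> hom Z2_Spaces (realization_space K) (realization_space L)"
proof -
  have K: "K \<in> finite_z2_complexes" and L: "L \<in> finite_z2_complexes"
    and f: "f \<in> vertices K \<rightarrow> vertices L" "z2_simplicial K L f"
    using assms by (auto simp: hom_Z2_Complexes)
  have mem: "pushforward (vertices K) f p \<in> realization_points L" if "p \<in> realization_points K" for p
    using pushforward_realization_points[OF K L f(1) _ that] f(2) by (simp add: z2_simplicial_def)
  have inv: "invol K \<in> vertices K \<rightarrow> vertices K" "invol L \<in> vertices L \<rightarrow> vertices L"
    using invol_vertex K L by auto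
  note fin = finite_vertices[OF K] finite_vertices[OF L]
  have "pushforward (vertices K) f (pushforward (vertices K) (invol K) p) =
      pushforward (vertices L) (invol L) (pushforward (vertices K) f p)" for p
    unfolding pushforward_pushforward[OF fin(1,1) inv(1)] pushforward_pushforward[OF fin f(1)]
    using z2_simplicial_invol[OF f(2)] by (auto intro: pushforward_cong)
  then have "equivariant (realization_space K) (realization_space L)
      (restrict (pushforward (vertices K) f) (realization_points K))"
    using flip_mem[OF realization_space_z2_space[OF K]] mem
    by (simp add: equivariant_def flip_realization_space)
  moreover have "continuous_map (topo (realization_space K)) (topo (realization_space L))
      (restrict (pushforward (vertices K) f) (realization_points K))"
    using mem by (simp add: realization_space_def continuous_map_restrict_top_of_set
        continuous_on_pushforward del: continuous_map_subtopology_eu)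
  ultimately show ?thesis
    using mem realization_space_z2_space[OF K] realization_space_z2_space[OF L]
    by (simp add: realization_def hom_Z2_Spaces z2_map_def)
qed

lemma cat_functor_realization: "cat_functor Z2_Complexes Z2_Spaces realization"
proof -
  interpret S: category Z2_Complexes by (rule category_Z2_Complexes)
  interpret T: category Z2_Spaces by (rule category_Z2_Spaces)
  show ?thesis
  proof
    show "omap realization K \<in> obj Z2_Spaces" if "K \<in> obj Z2_Complexes" for K
      using realization_space_z2_space that by (simp add: realization_def)
    show "amap realization a \<in> hom Z2_Spaces (omap realization K) (omap realization L)"
      if "a \<in> hom Z2_Complexes K L" for a K L
      using realization_hom[of K "umap a" L] hom_Z2_Complexes_umap[OF that] that
      by (simp add: realization_def)
    show "amap realization (ident Z2_Complexes K) = ident Z2_Spaces (omap realization K)"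
      if "K \<in> obj Z2_Complexes" for K
      using pushforward_ident[of _ "vertices K"]
      by (auto simp: realization_def realization_points_def intro!: restrict_ext)
    show "amap realization (cmp Z2_Complexes b a) = cmp Z2_Spaces (amap realization b) (amap realization a)"
      if ab: "a \<in> hom Z2_Complexes K L" "b \<in> hom Z2_Complexes L M" for a b K L M
    proof -
      obtain f g where a: "a = (K, f, L)" and b: "b = (L, g, M)"
        and K: "K \<in> finite_z2_complexes" and L: "L \<in> finite_z2_complexes"
        and f: "f \<in> vertices K \<rightarrow> vertices L" "simplicial K L f"
        using ab by (auto simp: hom_Z2_Complexes z2_simplicial_def)
      have "pushforward (vertices K) (compose (vertices K) g f) p =
          pushforward (vertices L) g (pushforward (vertices K) f p)" for p
        unfolding pushforward_pushforward[OF finite_vertices[OF K] finite_vertices[OF L] f(1)]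
        by (rule pushforward_cong) (simp add: compose_def)
      then show ?thesis
        using pushforward_realization_points[OF K L f]
        by (auto simp: a b realization_def compose_def intro!: restrict_ext)
    qed
  qed
qed

section \<open>The box complex functor and composition of functors\<close>

lemma box_point_mapsto:
  assumes "G \<in> finite_graphs" "H \<in> finite_graphs" "f \<in> verts G \<rightarrow> verts H" "graph_hom G H f"
    and "(s, t) \<in> box_points G"
  shows "(pushforward (verts G) f s, pushforward (verts G) f t) \<in> box_points H"
proof -
  have fin: "finite (verts G)" "finite (verts H)"
    using assms(1,2) by (auto simp: finite_graphs_def)
  have st: "s \<in> prob_dists (verts G)" "t \<in> prob_dists (verts G)" "supp s \<times> supp t \<subseteq> edges G"
    using assms(5) by (auto simp: box_points_def)
  have "f ` supp s \<times> f ` supp t \<subseteq> edges H"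
    using st(3) assms(4) by (force simp: graph_hom_def)
  then show ?thesis
    using pushforward_in_prob_dists[OF fin assms(3)] st(1,2)
    by (simp add: box_points_def supp_pushforward[OF fin(1)])
qed

lemma box_space_z2_space: "box_space G \<in> z2_spaces" if "G \<in> finite_graphs"
proof -
  have swap: "(t, s) \<in> box_points G" if "(s, t) \<in> box_points G" for s t
    using that \<open>G \<in> finite_graphs\<close> by (auto simp: box_points_def finite_graphs_def sym_def)
  moreover have "continuous_on (box_points G) (\<lambda>(s, t). (t, s))"
    unfolding case_prod_beta by (intro continuous_intros)
  ultimately show ?thesis
    unfolding z2_spaces_def
    by (auto simp: box_space_def continuous_map_restrict_top_of_set simp del: continuous_map_subtopology_eu)
qed

lemma box_hom:
  assumes "(G, f, H) \<in> hom Graphs G H"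
  shows "amap box_complex (G, f, H) \<in> hom Z2_Spaces (box_space G) (box_space H)"
proof -
  have G: "G \<in> finite_graphs" and H: "H \<in> finite_graphs"
    and f: "f \<in> verts G \<rightarrow> verts H" "graph_hom G H f"
    using assms by (auto simp: hom_Graphs)
  let ?F = "\<lambda>(s, t). (pushforward (verts G) f s, pushforward (verts G) f t)"
  have mem: "?F \<in> box_points G \<rightarrow> box_points H"
    using box_point_mapsto[OF G H f] by auto
  have "continuous_on (box_points G) ?F"
    unfolding case_prod_beta
    by (intro continuous_on_Pair continuous_on_compose2[OF continuous_on_pushforward _ subset_UNIV]
        continuous_on_fst continuous_on_snd continuous_on_id)
  then have "continuous_map (topo (box_space G)) (topo (box_space H)) (restrict ?F (box_points G))"
    using mem by (simp add: box_space_def continuous_map_restrict_top_of_set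
        del: continuous_map_subtopology_eu)
  moreover have "equivariant (box_space G) (box_space H) (restrict ?F (box_points G))"
    using box_point_mapsto[OF G H f] flip_mem[OF box_space_z2_space[OF G]]
    by (auto simp: equivariant_def flip_box_space)
  ultimately show ?thesis
    using mem box_space_z2_space[OF G] box_space_z2_space[OF H]
    by (auto simp: box_complex_def hom_Z2_Spaces z2_map_def)
qed

lemma hom_Graphs_umap: "a \<in> hom Graphs G H \<Longrightarrow> a = (G, umap a, H)"
  by (auto simp: hom_Graphs)

lemma cat_functor_box_complex: "cat_functor Graphs Z2_Spaces box_complex"
proof -
  interpret S: category Graphs by (rule category_Graphs)
  interpret T: category Z2_Spaces by (rule category_Z2_Spaces)
  show ?thesis
  proof
    show "omap box_complex G \<in> obj Z2_Spaces" if "G \<in> obj Graphs" for G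
      using box_space_z2_space that by (simp add: box_complex_def)
    show "amap box_complex a \<in> hom Z2_Spaces (omap box_complex G) (omap box_complex H)"
      if "a \<in> hom Graphs G H" for a G H
      using box_hom[of G "umap a" H] hom_Graphs_umap[OF that] that by (simp add: box_complex_def)
    show "amap box_complex (ident Graphs G) = ident Z2_Spaces (omap box_complex G)"
      if "G \<in> obj Graphs" for G
      by (auto simp: box_complex_def box_points_def pushforward_ident intro!: restrict_ext)
    show "amap box_complex (cmp Graphs b a) = cmp Z2_Spaces (amap box_complex b) (amap box_complex a)"
      if ab: "a \<in> hom Graphs G H" "b \<in> hom Graphs H I" for a b G H I
    proof -
      obtain f g where a: "a = (G, f, H)" and b: "b = (H, g, I)"
        and G: "G \<in> finite_graphs" and H: "H \<in> finite_graphs"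
        and f: "f \<in> verts G \<rightarrow> verts H" "graph_hom G H f"
        using ab by (auto simp: hom_Graphs)
      have fin: "finite (verts G)" "finite (verts H)"
        using G H by (auto simp: finite_graphs_def)
      have "pushforward (verts G) (compose (verts G) g f) p =
          pushforward (verts H) g (pushforward (verts G) f p)" for p
        unfolding pushforward_pushforward[OF fin f(1)]
        by (rule pushforward_cong) (simp add: compose_def)
      then show ?thesis
        using box_point_mapsto[OF G H f]
        by (auto simp: a b box_complex_def compose_def intro!: restrict_ext)
    qed
  qed
qed

lemma cat_functor_ftor_comp:
  assumes "cat_functor C D F" "cat_functor D E G"
  shows "cat_functor C E (ftor_comp G F)"
proof -
  interpret F: cat_functor C D F by fact
  interpret G: cat_functor D E G by fact
  show ?thesis
  proof
    show "omap (ftor_comp G F) X \<in> obj E" if "X \<in> obj C" for X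
      using G.omap_obj[OF F.omap_obj[OF that]] by (simp add: ftor_comp_def)
    show "amap (ftor_comp G F) f \<in> hom E (omap (ftor_comp G F) X) (omap (ftor_comp G F) Y)"
      if "f \<in> hom C X Y" for f X Y
      using G.amap_hom[OF F.amap_hom[OF that]] by (simp add: ftor_comp_def)
    show "amap (ftor_comp G F) (ident C X) = ident E (omap (ftor_comp G F) X)" if "X \<in> obj C" for X
      using F.amap_ident[OF that] G.amap_ident[OF F.omap_obj[OF that]] by (simp add: ftor_comp_def)
    show "amap (ftor_comp G F) (cmp C g f) = cmp E (amap (ftor_comp G F) g) (amap (ftor_comp G F) f)"
      if "f \<in> hom C X Y" "g \<in> hom C Y Z" for f g X Y Z
      using F.amap_cmp[OF that] G.amap_cmp[OF F.amap_hom[OF that(1)] F.amap_hom[OF that(2)]]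
      by (simp add: ftor_comp_def)
  qed
qed

section \<open>Marginals and product distributions\<close>

text \<open>A point of the realization of an edge model is a distribution on the edges of \<open>G\<close>, and it
  is sent to its pair of marginals.\<close>

definition marginals ::
    "'u z2_complex \<Rightarrow> ('u \<Rightarrow> 'u) \<Rightarrow> ('u \<Rightarrow> real) \<Rightarrow> ('u \<Rightarrow> real) \<times> ('u \<Rightarrow> real)" where
  "marginals K \<epsilon> p = (pushforward (vertices K) \<epsilon> p, pushforward (vertices K) (\<epsilon> \<circ> invol K) p)"

text \<open>The vertex \<open>v\<close> codes the edge
  \<open>(\<epsilon> v, \<epsilon> (invol K v))\<close>, so these are the weights of a product
  measure; at a point of the box complex this measure has no mass off the edges.\<close>

definition product_dist ::
    "'u z2_complex \<Rightarrow> ('u \<Rightarrow> 'u) \<Rightarrow> ('u \<Rightarrow> real) \<times> ('u \<Rightarrow> real) \<Rightarrow> 'u \<Rightarrow> real" where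
  "product_dist K \<epsilon> st = (\<lambda>v. if v \<in> vertices K then fst st (\<epsilon> v) * snd st (\<epsilon> (invol K v)) else 0)"

lemma continuous_on_marginals: "continuous_on S (marginals K \<epsilon>)"
  unfolding marginals_def by (intro continuous_on_Pair continuous_on_pushforward)

lemma continuous_on_product_dist: "continuous_on S (product_dist K \<epsilon>)"
proof (rule continuous_on_coordinatewise_then_product)
  fix v
  show "continuous_on S (\<lambda>st. product_dist K \<epsilon> st v)"
  proof (cases "v \<in> vertices K")
    case True
    then have "(\<lambda>st. product_dist K \<epsilon> st v) = (\<lambda>st. fst st (\<epsilon> v) * snd st (\<epsilon> (invol K v)))"
      by (simp add: product_dist_def)
    then show ?thesis
      by (simp only:) (rule continuous_on_mult[OF continuous_on_apply[OF continuous_on_fst[OF continuous_on_id]]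
          continuous_on_apply[OF continuous_on_snd[OF continuous_on_id]]])
  qed (simp add: product_dist_def)
qed

context
  fixes G :: "'u graph" and K :: "'u z2_complex" and \<epsilon> :: "'u \<Rightarrow> 'u"
  assumes G: "G \<in> finite_graphs" and m: "edge_model G K \<epsilon>"
begin

lemma edge_model_finite: "finite (vertices K)" "finite (verts G)"
  using finite_vertices[OF edge_model_complex[OF m]] G by (auto simp: finite_graphs_def)

lemma edge_model_vertex: "v \<in> vertices K \<Longrightarrow> \<epsilon> v \<in> verts G"
  by (rule PiE_mem[OF edge_model_map[OF m]])

lemma marginals_in_box_points:
  assumes p: "p \<in> realization_points K"
  shows "marginals K \<epsilon> p \<in> box_points G"
proof -
  note K = edge_model_complex[OF m]
  have "p \<in> prob_dists (vertices K)" and supp: "supp p \<in> simplices K"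
    using p by (auto simp: realization_points_def)
  moreover have "\<epsilon> ` supp p \<times> (\<epsilon> \<circ> invol K) ` supp p \<subseteq> edges G"
    using supp edge_model_simplex_iff[OF m] by auto
  moreover have "\<epsilon> \<in> vertices K \<rightarrow> verts G" "\<epsilon> \<circ> invol K \<in> vertices K \<rightarrow> verts G"
    using edge_model_vertex invol_vertex[OF K] by auto
  ultimately show ?thesis
    using edge_model_finite
    by (simp add: marginals_def box_points_def supp_pushforward pushforward_in_prob_dists)
qed

text \<open>The vertices enumerate the edges, and terms off the edges vanish. Sums over the complex
  become sums over the full square, where products factor.\<close>

lemma sum_vertices_edge_model:
  assumes "\<And>x y. x \<in> verts G \<Longrightarrow> y \<in> verts G \<Longrightarrow> (x, y) \<notin> edges G \<Longrightarrow> h x y = (0::real)"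
  shows "(\<Sum>v\<in>vertices K. h (\<epsilon> v) (\<epsilon> (invol K v))) = (\<Sum>x\<in>verts G. \<Sum>y\<in>verts G. h x y)"
proof -
  have "(\<Sum>v\<in>vertices K. h (\<epsilon> v) (\<epsilon> (invol K v))) = (\<Sum>(x, y)\<in>edges G. h x y)"
    using sum.reindex_bij_betw[OF edge_model_bij[OF m], of "\<lambda>(x, y). h x y"] by simp
  also have "\<dots> = (\<Sum>(x, y)\<in>verts G \<times> verts G. h x y)"
    using G assms by (intro sum.mono_neutral_left) (auto simp: finite_graphs_def)
  also have "\<dots> = (\<Sum>x\<in>verts G. \<Sum>y\<in>verts G. h x y)"
    by (rule sum.cartesian_product[symmetric])
  finally show ?thesis .
qed

text \<open>The total mass factors into two masses equal to one. For \<open>v\<close> and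
  \<open>w\<close> in the support, \<open>\<epsilon> v\<close> lies in the support of
  \<open>s\<close> and \<open>\<epsilon> (invol K w)\<close> in that of \<open>t\<close>, so the
  rectangle condition on \<open>(s, t)\<close> yields the simplex condition.\<close>

lemma product_dist_in_realization_points:
  assumes st: "st \<in> box_points G"
  shows "product_dist K \<epsilon> st \<in> realization_points K"
proof -
  obtain s t where [simp]: "st = (s, t)" by (cases st)
  have s: "s \<in> prob_dists (verts G)" and t: "t \<in> prob_dists (verts G)"
    and supp: "supp s \<times> supp t \<subseteq> edges G"
    using st by (auto simp: box_points_def)
  have "sum (product_dist K \<epsilon> st) (vertices K) = (\<Sum>v\<in>vertices K. s (\<epsilon> v) * t (\<epsilon> (invol K v)))"
    by (intro sum.cong) (simp_all add: product_dist_def)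
  also have "\<dots> = (\<Sum>x\<in>verts G. \<Sum>y\<in>verts G. s x * t y)"
    using supp by (intro sum_vertices_edge_model) (auto simp: supp_def)
  also have "\<dots> = 1"
    using prob_dist_sum[OF s] prob_dist_sum[OF t] by (simp add: sum_product[symmetric])
  finally have prob: "product_dist K \<epsilon> st \<in> prob_dists (vertices K)"
    using prob_dist_nonneg[OF s] prob_dist_nonneg[OF t] by (simp add: prob_dists_def product_dist_def)
  moreover have "supp (product_dist K \<epsilon> st) \<in> simplices K"
    unfolding edge_model_simplex_iff[OF m]
    using supp_nonempty[OF prob] supp_subset[OF prob] supp by (auto simp: supp_def product_dist_def)
  ultimately show ?thesis
    by (simp add: realization_points_def)
qed

text \<open>Summing out one variable leaves a factor of total mass one. As this is an equality, only
  the composite in the other order needs a homotopy.\<close>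

lemma marginals_product_dist:
  assumes st: "st \<in> box_points G"
  shows "marginals K \<epsilon> (product_dist K \<epsilon> st) = st"
proof -
  obtain s t where [simp]: "st = (s, t)" by (cases st)
  have s: "s \<in> prob_dists (verts G)" and t: "t \<in> prob_dists (verts G)"
    and supp: "supp s \<times> supp t \<subseteq> edges G"
    using st by (auto simp: box_points_def)
  \<comment> \<open>The fibre condition becomes a conditional summand, so that
    \<open>sum_vertices_edge_model\<close> can be applied.\<close>
  have push: "pushforward (vertices K) f (product_dist K \<epsilon> st) z =
      (\<Sum>v\<in>vertices K. if f v = z then s (\<epsilon> v) * t (\<epsilon> (invol K v)) else 0)" for f z
    unfolding pushforward_def product_dist_def using edge_model_finite(1)
    by (subst sum.inter_filter[symmetric]) (auto intro: sum.cong)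
  have "pushforward (vertices K) \<epsilon> (product_dist K \<epsilon> st) z = s z" for z
  proof -
    have "pushforward (vertices K) \<epsilon> (product_dist K \<epsilon> st) z =
        (\<Sum>x\<in>verts G. \<Sum>y\<in>verts G. if x = z then s x * t y else 0)"
      unfolding push using supp by (intro sum_vertices_edge_model) (auto simp: supp_def)
    also have "\<dots> = (\<Sum>x\<in>verts G. if x = z then s x else 0)"
      using prob_dist_sum[OF t] by (intro sum.cong) (auto simp: sum_distrib_left[symmetric])
    also have "\<dots> = s z"
      using edge_model_finite(2) prob_dist_outside[OF s] by simp
    finally show ?thesis .
  qed
  moreover have "pushforward (vertices K) (\<epsilon> \<circ> invol K) (product_dist K \<epsilon> st) z = t z" for z
  proof -
    have "pushforward (vertices K) (\<epsilon> \<circ> invol K) (product_dist K \<epsilon> st) z =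
        (\<Sum>x\<in>verts G. \<Sum>y\<in>verts G. if y = z then s x * t y else 0)"
      unfolding push o_apply using supp by (intro sum_vertices_edge_model) (auto simp: supp_def)
    also have "\<dots> = (\<Sum>x\<in>verts G. s x * t z)"
      using edge_model_finite(2) prob_dist_outside[OF t] by (intro sum.cong) auto
    also have "\<dots> = t z"
      using prob_dist_sum[OF s] by (simp add: sum_distrib_right[symmetric])
    finally show ?thesis .
  qed
  ultimately show ?thesis
    by (simp add: marginals_def fun_eq_iff)
qed

lemma flip_edge_model:
  "p \<in> realization_points K \<Longrightarrow>
     flip (realization_space K) p v = (if v \<in> vertices K then p (invol K v) else 0)"
  using pushforward_involution[OF invol_vertex invol_invol, OF edge_model_complex[OF m] _ edge_model_complex[OF m]]
  by (simp add: flip_realization_space)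

text \<open>The second marginal is the first one taken after the involution, which squares to the
  identity; flipping \<open>p\<close> therefore exchanges the two.\<close>

lemma equivariant_marginals:
  "equivariant (realization_space K) (box_space G) (marginals K \<epsilon>)"
  unfolding equivariant_def
proof
  fix p assume "p \<in> topspace (topo (realization_space K))"
  then have p: "p \<in> realization_points K"
    by simp
  note K = edge_model_complex[OF m]
  have inv: "invol K \<in> vertices K \<rightarrow> vertices K"
    using invol_vertex[OF K] by auto
  have "pushforward (vertices K) (\<epsilon> \<circ> invol K \<circ> invol K) p = pushforward (vertices K) \<epsilon> p"
    using invol_invol[OF K] by (intro pushforward_cong) simp
  then have "marginals K \<epsilon> (pushforward (vertices K) (invol K) p) =
      (snd (marginals K \<epsilon> p), fst (marginals K \<epsilon> p))"
    by (simp add: marginals_def pushforward_pushforward[OF edge_model_finite(1,1) inv])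
  then show "marginals K \<epsilon> (flip (realization_space K) p) = flip (box_space G) (marginals K \<epsilon> p)"
    using p marginals_in_box_points[OF p]
      flip_box_space[of "fst (marginals K \<epsilon> p)" "snd (marginals K \<epsilon> p)" G]
    by (simp add: flip_realization_space)
qed

lemma equivariant_product_dist:
  "equivariant (box_space G) (realization_space K) (product_dist K \<epsilon>)"
  unfolding equivariant_def
proof
  fix st assume "st \<in> topspace (topo (box_space G))"
  then have st: "st \<in> box_points G"
    by simp
  obtain s t where [simp]: "st = (s, t)" by (cases st)
  note K = edge_model_complex[OF m]
  show "product_dist K \<epsilon> (flip (box_space G) st) = flip (realization_space K) (product_dist K \<epsilon> st)"
    using st flip_edge_model[OF product_dist_in_realization_points[OF st]]
      invol_vertex[OF K] invol_invol[OF K]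
    by (auto simp: flip_box_space product_dist_def)
qed

text \<open>The distribution \<open>p\<close> and the product of its marginals lie in a common simplex, so they are joined
  by a segment.\<close>

lemma segment_in_realization_points:
  assumes p: "p \<in> realization_points K" and c: "c \<in> {0..1::real}"
  shows "(\<lambda>v. (1 - c) * product_dist K \<epsilon> (marginals K \<epsilon> p) v + c * p v) \<in> realization_points K"
    (is "?q \<in> _")
proof -
  let ?r = "product_dist K \<epsilon> (marginals K \<epsilon> p)"
  have r: "?r \<in> prob_dists (vertices K)" and p': "p \<in> prob_dists (vertices K)"
    and supp: "supp p \<in> simplices K"
    using p product_dist_in_realization_points[OF marginals_in_box_points[OF p]]
    by (auto simp: realization_points_def)
  have "sum ?q (vertices K) = 1"
    using prob_dist_sum[OF r] prob_dist_sum[OF p']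
    by (simp add: sum.distrib sum_distrib_left[symmetric])
  then have q: "?q \<in> prob_dists (vertices K)"
    using prob_dist_nonneg[OF r] prob_dist_nonneg[OF p'] prob_dist_outside[OF r]
      prob_dist_outside[OF p'] c by (auto simp: prob_dists_def)
  have marg: "supp (fst (marginals K \<epsilon> p)) = \<epsilon> ` supp p"
      "supp (snd (marginals K \<epsilon> p)) = (\<epsilon> \<circ> invol K) ` supp p"
    by (simp_all only: marginals_def fst_conv snd_conv supp_pushforward[OF edge_model_finite(1) p'])
  \<comment> \<open>A vertex outside the support of \<open>p\<close> enters only through the
    product, and then both marginals are non-zero at its ends; by \<open>marg\<close> each end also
    belongs to some edge in the support of \<open>p\<close>.\<close>
  have *: "\<epsilon> v \<in> \<epsilon> ` supp p \<and> \<epsilon> (invol K v) \<in> (\<epsilon> \<circ> invol K) ` supp p" if "v \<in> supp ?q" for v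
  proof (cases "v \<in> supp p")
    case False
    then have "?r v \<noteq> 0"
      using that by (auto simp: supp_def)
    then have "\<epsilon> v \<in> supp (fst (marginals K \<epsilon> p)) \<and> \<epsilon> (invol K v) \<in> supp (snd (marginals K \<epsilon> p))"
      by (auto simp: supp_def product_dist_def split: if_splits)
    then show ?thesis
      unfolding marg .
  qed simp
  \<comment> \<open>The simplex condition depends only on the sets of first and of second ends, and
    these have not grown.\<close>
  have "(\<epsilon> v, \<epsilon> (invol K w)) \<in> edges G" if "v \<in> supp ?q" "w \<in> supp ?q" for v w
    using *[OF that(1)] *[OF that(2)] supp unfolding edge_model_simplex_iff[OF m] by auto
  then have "supp ?q \<in> simplices K"
    unfolding edge_model_simplex_iff[OF m] using supp_nonempty[OF q] supp_subset[OF q] by blast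
  then show ?thesis
    using q by (simp add: realization_points_def)
qed

text \<open>Each stage is equivariant because the flip permutes coordinates, hence commutes with
  affine combinations, and because \<open>marginals\<close> and \<open>product_dist\<close> commute
  with the flips.\<close>

lemma product_dist_marginals_homotopic:
  "z2_homotopic (realization_space K) (realization_space K) (product_dist K \<epsilon> \<circ> marginals K \<epsilon>) id"
  unfolding z2_homotopic_def homotopic_with_def
proof (intro exI conjI allI ballI)
  let ?r = "\<lambda>p. product_dist K \<epsilon> (marginals K \<epsilon> p)"
  let ?h = "\<lambda>(c :: real, p) v. (1 - c) * ?r p v + c * p v"
  show "?h (0, p) = (product_dist K \<epsilon> \<circ> marginals K \<epsilon>) p" "?h (1, p) = id p" for p
    by auto
  have "continuous_on ({0..1} \<times> realization_points K) (\<lambda>z. ?h z v)" for v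
  proof -
    have "continuous_on UNIV ?r"
      by (rule continuous_on_compose2[OF continuous_on_product_dist continuous_on_marginals])
        (rule subset_UNIV)
    then have "continuous_on ({0..1} \<times> realization_points K) (\<lambda>z. ?r (snd z))"
      by (rule continuous_on_compose2[OF _ continuous_on_snd[OF continuous_on_id] subset_UNIV])
    then have 1: "continuous_on ({0..1} \<times> realization_points K) (\<lambda>z. ?r (snd z) v)"
      by (rule continuous_on_apply)
    have 2: "continuous_on ({0..1} \<times> realization_points K) (\<lambda>z. snd z v)"
      by (rule continuous_on_apply[OF continuous_on_snd[OF continuous_on_id]])
    show ?thesis
      unfolding case_prod_beta
      by (intro continuous_on_add continuous_on_mult continuous_on_diff continuous_on_const
          continuous_on_fst continuous_on_id 1 2)
  qed
  then have "continuous_on ({0..1} \<times> realization_points K) ?h"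
    by (rule continuous_on_coordinatewise_then_product)
  then show "continuous_map (prod_topology (top_of_set {0..1}) (topo (realization_space K)))
      (topo (realization_space K)) ?h"
    using segment_in_realization_points by (auto simp: realization_space_def)
  show "equivariant (realization_space K) (realization_space K) (\<lambda>p. ?h (c, p))" if c: "c \<in> {0..1}" for c
    unfolding equivariant_def
  proof
    fix p assume "p \<in> topspace (topo (realization_space K))"
    then have p: "p \<in> realization_points K"
      by simp
    note r = product_dist_in_realization_points[OF marginals_in_box_points[OF p]]
    have "?r (flip (realization_space K) p) = flip (realization_space K) (?r p)"
      using equivariant_marginals equivariant_product_dist p marginals_in_box_points[OF p]
      by (simp add: equivariant_def)
    then show "?h (c, flip (realization_space K) p) = flip (realization_space K) (?h (c, p))"
      using flip_edge_model[OF p] flip_edge_model[OF r]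
        flip_edge_model[OF segment_in_realization_points[OF p c]] by (auto simp: fun_eq_iff)
  qed
qed

lemma z2_homotopy_equivalence_marginals:
  "z2_homotopy_equivalence (realization_space K) (box_space G) (marginals K \<epsilon>)"
  unfolding z2_homotopy_equivalence_def
proof (intro conjI exI)
  show "z2_map (realization_space K) (box_space G) (marginals K \<epsilon>)"
    using equivariant_marginals marginals_in_box_points continuous_on_marginals
    by (simp add: z2_map_def realization_space_def box_space_def)
  show g: "z2_map (box_space G) (realization_space K) (product_dist K \<epsilon>)"
    using equivariant_product_dist product_dist_in_realization_points continuous_on_product_dist
    by (simp add: z2_map_def realization_space_def box_space_def)
  show "z2_homotopic (realization_space K) (realization_space K) (product_dist K \<epsilon> \<circ> marginals K \<epsilon>) id"
    by (rule product_dist_marginals_homotopic)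
  \<comment> \<open>The two maps are known to agree on the points of the box complex, which is
    enough for a constant homotopy.\<close>
  show "z2_homotopic (box_space G) (box_space G) (marginals K \<epsilon> \<circ> product_dist K \<epsilon>) id"
    unfolding z2_homotopic_def
  proof (rule homotopic_with_equal)
    have id: "(marginals K \<epsilon> \<circ> product_dist K \<epsilon>) x = id x" if "x \<in> topspace (topo (box_space G))" for x
      using marginals_product_dist that by simp
    then show "equivariant (box_space G) (box_space G) (marginals K \<epsilon> \<circ> product_dist K \<epsilon>)"
      using flip_mem[OF box_space_z2_space[OF G]] by (simp add: equivariant_def)
    show "equivariant (box_space G) (box_space G) id"
      by (simp add: equivariant_def)
    show "continuous_map (topo (box_space G)) (topo (box_space G)) (marginals K \<epsilon> \<circ> product_dist K \<epsilon>)"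
      by (rule continuous_map_eq[OF continuous_map_id]) (use id in simp)
    show "(marginals K \<epsilon> \<circ> product_dist K \<epsilon>) x = id x" if "x \<in> topspace (topo (box_space G))" for x
      by (rule id[OF that])
  qed
qed

end

text \<open>The counit of \<open>R\<close> consists of universal arrows, so every
  \<open>omap R G\<close> is an edge model with the counit \<open>\<epsilon> G\<close> as its
  first-end map. The marginals are then natural because push-forward respects composition and the
  counit is natural.\<close>

lemma realization_right_adjoint_box_complex:
  assumes inf: "infinite (UNIV :: 'u set)"
    and adj: "adjunction Z2_Complexes Graphs (csorba :: ('u z2_complex, _, _, _) ftor) R"
  shows "naturally_z2_homotopy_equivalent Graphs (ftor_comp realization R) box_complex"
proof -
  have R: "cat_functor Graphs Z2_Complexes R"
    using adj[unfolded adjunction_def] by (rule conjunct2[THEN conjunct1])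
  then interpret R: cat_functor Graphs Z2_Complexes R .
  obtain e where u: "\<And>G. G \<in> obj Graphs \<Longrightarrow> universal_arrow Z2_Complexes Graphs csorba G (omap R G) (e G)"
    and nat: "\<And>G H a. a \<in> hom Graphs G H \<Longrightarrow>
      cmp Graphs a (e G) = cmp Graphs (e H) (amap csorba (amap R a))"
    using adjunction_counit[OF adj] by metis
  define \<epsilon> where "\<epsilon> G = umap (e G)" for G
  have model: "edge_model G (omap R G) (\<epsilon> G)" if "G \<in> finite_graphs" for G
    using edge_model_if_universal[OF inf that u] that by (simp add: \<epsilon>_def)
  have e: "e G = (csorba_graph (omap R G), \<epsilon> G, G)" if "G \<in> finite_graphs" for G
    using u[of G] that by (auto simp: universal_arrow_def hom_Graphs \<epsilon>_def)
  show ?thesis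
    unfolding naturally_z2_homotopy_equivalent_def
  proof (intro conjI exI[of _ "\<lambda>G. marginals (omap R G) (\<epsilon> G)"] ballI)
    show "cat_functor Graphs Z2_Spaces (ftor_comp realization R)"
      by (rule cat_functor_ftor_comp[OF R cat_functor_realization])
    show "cat_functor Graphs Z2_Spaces box_complex"
      by (rule cat_functor_box_complex)
    show "z2_homotopy_equivalence (omap (ftor_comp realization R) G) (omap box_complex G)
        (marginals (omap R G) (\<epsilon> G))" if "G \<in> obj Graphs" for G
      using z2_homotopy_equivalence_marginals[OF _ model] that
      by (simp add: ftor_comp_def realization_def box_complex_def)
    fix G H :: "'u graph" and a p
    assume "G \<in> obj Graphs" "H \<in> obj Graphs" and a: "a \<in> hom Graphs G H"
      and "p \<in> topspace (topo (omap (ftor_comp realization R) G))"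
    then have G: "G \<in> finite_graphs" and H: "H \<in> finite_graphs"
      and p: "p \<in> realization_points (omap R G)"
      by (simp_all add: ftor_comp_def realization_def)
    let ?K = "omap R G" and ?L = "omap R H"
    obtain f where f: "a = (G, f, H)"
      using a by (auto simp: hom_Graphs)
    obtain k where k: "amap R a = (?K, k, ?L)" "k \<in> vertices ?K \<rightarrow> vertices ?L" "z2_simplicial ?K ?L k"
      using R.amap_hom[OF a] by (auto simp: hom_Z2_Complexes)
    have K: "?K \<in> finite_z2_complexes"
      by (rule edge_model_complex[OF model[OF G]])
    have L: "?L \<in> finite_z2_complexes"
      by (rule edge_model_complex[OF model[OF H]])
    \<comment> \<open>This is naturality of the counit read on underlying maps; together with
      equivariance of \<open>k\<close> it also gives the square for second ends.\<close>
    have "compose (vertices ?K) f (\<epsilon> G) = compose (vertices ?K) (\<epsilon> H) k"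
      using nat[OF a] e[OF G] e[OF H] k(1) f by simp
    then have square: "f (\<epsilon> G v) = \<epsilon> H (k v)" if "v \<in> vertices ?K" for v
      using that by (metis compose_eq)
    have square': "f (\<epsilon> G (invol ?K v)) = \<epsilon> H (invol ?L (k v))" if "v \<in> vertices ?K" for v
      using square[OF invol_vertex[OF K that]] z2_simplicial_invol[OF k(3) that] by simp
    note fin = edge_model_finite[OF G model[OF G]] finite_vertices[OF L]
    have \<epsilon>: "\<epsilon> G \<in> vertices ?K \<rightarrow> verts G" "\<epsilon> G \<circ> invol ?K \<in> vertices ?K \<rightarrow> verts G"
      using edge_model_vertex[OF G model[OF G]] invol_vertex[OF K] by auto
    have "marginals ?L (\<epsilon> H) (pushforward (vertices ?K) k p) =
        (pushforward (vertices ?K) (\<epsilon> H \<circ> k) p, pushforward (vertices ?K) (\<epsilon> H \<circ> invol ?L \<circ> k) p)"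
      by (simp add: marginals_def pushforward_pushforward[OF fin(1,3) k(2)])
    also have "\<dots> = (pushforward (vertices ?K) (f \<circ> \<epsilon> G) p,
        pushforward (vertices ?K) (f \<circ> (\<epsilon> G \<circ> invol ?K)) p)"
      using square square' by (auto intro: pushforward_cong)
    also have "\<dots> = (pushforward (verts G) f (fst (marginals ?K (\<epsilon> G) p)),
        pushforward (verts G) f (snd (marginals ?K (\<epsilon> G) p)))"
      by (simp add: marginals_def pushforward_pushforward[OF fin(1,2) \<epsilon>(1)]
          pushforward_pushforward[OF fin(1,2) \<epsilon>(2)])
    finally show "marginals ?L (\<epsilon> H) (umap (amap (ftor_comp realization R) a) p) =
        umap (amap box_complex a) (marginals ?K (\<epsilon> G) p)"
      using p marginals_in_box_points[OF G model[OF G] p] k(1) f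
      by (simp add: ftor_comp_def realization_def box_complex_def case_prod_beta)
  qed
qed

theorem theorem1p5:
  assumes "infinite (UNIV :: 'u set)"
  shows
    "(\<exists>R. adjunction Z2_Complexes Graphs (csorba :: ('u z2_complex, _, _, _) ftor) R) \<and>
     (\<forall>J :: ('i, 'j) cat. finite_category J \<longrightarrow>
        preserves_limits_of_shape J Z2_Complexes Graphs (csorba :: ('u z2_complex, _, _, _) ftor)) \<and>
     (\<forall>R. adjunction Z2_Complexes Graphs (csorba :: ('u z2_complex, _, _, _) ftor) R \<longrightarrow>
        naturally_z2_homotopy_equivalent Graphs (ftor_comp realization R) box_complex)"
  using csorba_right_adjoint[OF assms] csorba_preserves_limits[OF assms]
    realization_right_adjoint_box_complex[OF assms]
  by (intro conjI allI impI)

end
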